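(* Let $N\ge 2$ be an integer and $\alpha>-1$ a real number. Then for every integer $k\ge 1$, $$C(N,\alpha,k)=\sqrt{(N+2\alpha)^2+4(N-2+k)k}-(N+2\alpha).$$ As a consequence, $$\inf_{k\in\mathbb{N},\,k\ge 1}C(N,\alpha,k)=C(N,\alpha,1)=\sqrt{(N+2\alpha)^2+4(N-1)}-(N+2\alpha).$$
   Context: For integers $N\ge2$, $k\ge1$ and real $\alpha>-1$, $$C(N,\alpha,k):=\inf_{u}\frac{\int_{\mathbb{R}^{N+2k}}\frac{|\Delta u|^2}{|x|^{2\alpha}}\,dx+\int_{\mathbb{R}^{N+2k}}\left[|x|^{2\alpha+2}|\nabla u|^2-2(\alpha+1)k\,|x|^{2\alpha}|u|^2\right]dx}{\int_{\mathbb{R}^{N+2k}}|\nabla u|^2\,dx}-(N+4\alpha+2),$$ where the infimum is over all nonzero radial real-valued functions $u\in C_c^\infty(\mathbb{R}^{N+2k})$ with $\int_{\mathbb{R}^{N+2k}}|x|^{-2\alpha}|\Delta u|^2\,dx<\infty$. *)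

theory Defs
  imports "HOL-Analysis.Analysis"
begin

text \<open>
  The dimension \<open>N + 2 * k\<close> varies inside the statement (there is an infimum over \<open>k\<close>), so
  it cannot be a type. As in \<open>HOL-Analysis.Ball_Volume\<close>, a point of \<open>n\<close>-dimensional Euclidean
  space is a function \<open>x :: nat \<Rightarrow> real\<close> that is \<open>undefined\<close> outside \<open>{..<n}\<close>, and the measure is
  the product of \<open>n\<close> copies of \<open>lborel\<close>. The Euclidean norm of \<open>x\<close> is \<open>L2_set x {..<n}\<close>, and the
  topology of \<open>Rn n\<close> is the subspace topology of the product topology on \<open>nat \<Rightarrow> real\<close>, which on
  \<open>Rn n\<close> is the Euclidean one. A real function on the space is a
  \<open>u :: (nat \<Rightarrow> real) \<Rightarrow> real\<close>; its values outside \<open>Rn n\<close> are never used.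
\<close>

definition Rn :: "nat \<Rightarrow> (nat \<Rightarrow> real) set" where
  "Rn n = PiE {..<n} (\<lambda>_. UNIV)"

definition lebesgue_Rn :: "nat \<Rightarrow> (nat \<Rightarrow> real) measure" where
  "lebesgue_Rn n = PiM {..<n} (\<lambda>_. lborel)"

definition partial_deriv :: "nat \<Rightarrow> ((nat \<Rightarrow> real) \<Rightarrow> real) \<Rightarrow> (nat \<Rightarrow> real) \<Rightarrow> real" where
  "partial_deriv i u x = deriv (\<lambda>t. u (x(i := t))) (x i)"

definition grad_norm_sq :: "nat \<Rightarrow> ((nat \<Rightarrow> real) \<Rightarrow> real) \<Rightarrow> (nat \<Rightarrow> real) \<Rightarrow> real" where
  "grad_norm_sq n u x = (\<Sum>i<n. (partial_deriv i u x)\<^sup>2)"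

definition laplacian :: "nat \<Rightarrow> ((nat \<Rightarrow> real) \<Rightarrow> real) \<Rightarrow> (nat \<Rightarrow> real) \<Rightarrow> real" where
  "laplacian n u x = (\<Sum>i<n. partial_deriv i (partial_deriv i u) x)"

text \<open>
  Smoothness: every iterated partial derivative (of every order, including order 0) is
  continuous and again has all first partial derivatives. The explicit differentiability
  clause is needed because \<open>deriv\<close> is a total operator.
\<close>

definition smooth_Rn :: "nat \<Rightarrow> ((nat \<Rightarrow> real) \<Rightarrow> real) \<Rightarrow> bool" where
  "smooth_Rn n u \<longleftrightarrow>
     (\<forall>js. set js \<subseteq> {..<n} \<longrightarrow>
        continuous_on (Rn n) (foldr partial_deriv js u) \<and>
        (\<forall>i<n. \<forall>x\<in>Rn n.
           (\<lambda>t. foldr partial_deriv js u (x(i := t))) differentiable at (x i)))"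

definition compact_support_Rn :: "nat \<Rightarrow> ((nat \<Rightarrow> real) \<Rightarrow> real) \<Rightarrow> bool" where
  "compact_support_Rn n u \<longleftrightarrow> compact (closure {x \<in> Rn n. u x \<noteq> 0})"

definition radial_Rn :: "nat \<Rightarrow> ((nat \<Rightarrow> real) \<Rightarrow> real) \<Rightarrow> bool" where
  "radial_Rn n u \<longleftrightarrow>
     (\<forall>x\<in>Rn n. \<forall>y\<in>Rn n. L2_set x {..<n} = L2_set y {..<n} \<longrightarrow> u x = u y)"

definition admissible :: "nat \<Rightarrow> real \<Rightarrow> ((nat \<Rightarrow> real) \<Rightarrow> real) set" where
  "admissible n \<alpha> = {u.
     smooth_Rn n u \<and> compact_support_Rn n u \<and> radial_Rn n u \<and> (\<exists>x\<in>Rn n. u x \<noteq> 0) \<and>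
     integrable (lebesgue_Rn n)
       (\<lambda>x. (laplacian n u x)\<^sup>2 / L2_set x {..<n} powr (2 * \<alpha>))}"

text \<open>
  All integrals below converge for \<open>u \<in> admissible n \<alpha>\<close> when \<open>n \<ge> 4\<close> and \<open>\<alpha> > -1\<close>. The values
  of the weights at the origin (where \<open>0 powr a = 0\<close> and \<open>c / 0 = 0\<close>) do not matter, since a
  single point has measure zero.
\<close>

definition quotient :: "nat \<Rightarrow> real \<Rightarrow> nat \<Rightarrow> ((nat \<Rightarrow> real) \<Rightarrow> real) \<Rightarrow> real" where
  "quotient n \<alpha> k u =
     ((LINT x|lebesgue_Rn n. (laplacian n u x)\<^sup>2 / L2_set x {..<n} powr (2 * \<alpha>)) +
      (LINT x|lebesgue_Rn n.
         L2_set x {..<n} powr (2 * \<alpha> + 2) * grad_norm_sq n u x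
         - 2 * (\<alpha> + 1) * real k * L2_set x {..<n} powr (2 * \<alpha>) * (u x)\<^sup>2))
     / (LINT x|lebesgue_Rn n. grad_norm_sq n u x)"

text \<open>
  The infimum is taken in \<^typ>\<open>ereal\<close>, so that it is the genuine infimum also for a set that is
  empty or not bounded below.
\<close>

definition C_const :: "nat \<Rightarrow> real \<Rightarrow> nat \<Rightarrow> ereal" where
  "C_const N \<alpha> k =
     (INF u\<in>admissible (N + 2 * k) \<alpha>. ereal (quotient (N + 2 * k) \<alpha> k u))
     - ereal (real N + 4 * \<alpha> + 2)"

end

theory Submission
  imports Defs
begin

text \<open>
  Put \<open>n = N + 2k\<close> and let \<open>b\<close> be the larger root of \<open>b\<^sup>2 - (n + 2\<alpha>) b + 2(\<alpha> + 1)k = 0\<close>. Expanding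
  \<open>|x|\<^sup>-\<^sup>2\<^sup>\<alpha> (\<Delta>u + |x|\<^sup>2\<^sup>\<alpha> (x \<cdot> \<nabla>u + b u))\<^sup>2\<close> and integrating by parts shows that the numerator of the
  quotient is \<open>(2b - n + 2) \<integral>|\<nabla>u|\<^sup>2\<close> plus the integral of this square (the defect), which gives the
  lower bound. In the variable \<open>s = |x|\<^sup>m / m\<close> with \<open>m = 2\<alpha> + 2\<close> the defect vanishes for radial solutions
  of Kummer's equation \<open>s g'' + (c + s) g' + A g = 0\<close> with \<open>A = b/m\<close> and \<open>c = (n + 2\<alpha>)/m\<close>. The entire
  solution decays like \<open>s\<close> to the power \<open>-A\<close>, and \<open>2A > c\<close> is exactly what is needed to cut it off at
  infinity (and to make it constant near the origin) with defect tending to zero.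
\<close>

section \<open>Integration in polar coordinates\<close>

text \<open>Integration by parts leaves the coefficient b^2 - (n + 2\<alpha>) b + 2(\<alpha> + 1)k
  in front of |x|^(2\<alpha>) u^2, which is why b must be a root. The roots add up to n + 2\<alpha>,
  so only the larger one satisfies 2b > n + 2\<alpha>; the smaller one gives a weaker lower bound.
  In the radius, the squared residual of a truncation at infinity has size r^(-2b) against the
  weight r^(n - 1 + 2\<alpha>), and 2b > n + 2\<alpha> is integrability there. The other inequality
  b < n + 2\<alpha>, that is A < c, keeps the power series under control. A function of |x|^m is in
  general not smooth at the origin, hence the constant core. Both truncations are dilations of one
  fixed step, so their commutators with Kummer's operator obey bounds independent of the scale,
  while the residual at a fixed point is eventually zero. Dominated convergence then needs no rate.
  The Dirichlet integrals in the denominator stay away from 0 because the Kummer function has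
  nonzero slope on a fixed interval that the truncations eventually leave untouched.\<close>

lemma norm_distr_density:
  assumes n: "n \<ge> 1"
  shows "distr (PiM {..<n} (\<lambda>_. lborel)) borel (\<lambda>x. L2_set x {..<n})
    = density lborel (\<lambda>r. ennreal (indicator {0<..} r * (real n * unit_ball_vol (real n) * r ^ (n - 1))))"
    (is "?M = ?N")
\<comment> \<open>Half-lines \<open>{..r}\<close> determine both measures. On them one side is the
  volume of a ball of radius r and the other the integral of the derivative of that volume.\<close>
proof (rule measure_eqI_generator_eq[where \<Omega>=UNIV and E="range atMost" and A="\<lambda>i. {..real i}"])
  have meas: "(\<lambda>x. L2_set x {..<n}) \<in> borel_measurable (PiM {..<n} (\<lambda>_. lborel))"
    unfolding L2_set_def by measurable
  show "Int_stable (range (atMost :: real \<Rightarrow> _))"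
    by (auto simp: Int_stable_def)
  show "sets ?M = sigma_sets UNIV (range atMost)" "sets ?N = sigma_sets UNIV (range atMost)"
    by (simp_all add: borel_eq_atMost)
  have M: "emeasure ?M {..r} = ennreal (unit_ball_vol (real n) * (max 0 r) ^ n)" for r
  proof (cases "r \<ge> 0")
    case True
    have "emeasure ?M {..r} = emeasure (PiM {..<n} (\<lambda>_. lborel))
      ({x. sqrt (\<Sum>i\<in>{..<n}. (x i)\<^sup>2) \<le> r} \<inter> space (PiM {..<n} (\<lambda>_. lborel)))"
      by (subst emeasure_distr[OF meas]) (auto intro!: arg_cong[where f="emeasure _"] simp: L2_set_def)
    also have "\<dots> = ennreal (unit_ball_vol (real n) * r ^ n)"
    proof (cases "r > 0")
      case True
      then show ?thesis using emeasure_cball_aux[of "{..<n}" r] by simp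
    next
      case False
      with \<open>r \<ge> 0\<close> have r: "r = 0" by simp
      have "{x. sqrt (\<Sum>i\<in>{..<n}. (x i)\<^sup>2) \<le> r} \<inter> space (PiM {..<n} (\<lambda>_. lborel)) = PiE {..<n} (\<lambda>_. {0})"
        unfolding r
        by (auto simp: space_PiM PiE_def Pi_def sum_nonneg_eq_0_iff order_antisym_conv[OF sum_nonneg] extensional_def)
      moreover have "emeasure (PiM {..<n} (\<lambda>_. lborel)) (PiE {..<n} (\<lambda>_. {0::real})) = 0 ^ n"
      proof -
        interpret product_sigma_finite "\<lambda>_::nat. lborel :: real measure"
          by standard
        show ?thesis using emeasure_PiM[of "{..<n}" "\<lambda>_. {0}"] by simp
      qed
      ultimately show ?thesis using n
        by (simp add: r zero_power)
    qed
    finally show ?thesis using True by simp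
  next
    case False
    have "\<not> L2_set x {..<n} \<le> r" for x
      using False L2_set_nonneg[of x "{..<n}"] by linarith
    then have "(\<lambda>x. L2_set x {..<n}) -` {..r} = {}" by auto
    then have "emeasure ?M {..r} = emeasure (PiM {..<n} (\<lambda>_. lborel)) {}"
      by (subst emeasure_distr[OF meas]) auto
    then show ?thesis using False n by (simp add: max_def zero_power)
  qed
  have N: "emeasure ?N {..r} = ennreal (unit_ball_vol (real n) * (max 0 r) ^ n)" for r
  proof -
    have "emeasure ?N {..r} = (\<integral>\<^sup>+ x. ennreal (real n * unit_ball_vol (real n) * x ^ (n - 1)) * indicator {0..max 0 r} x \<partial>lborel)"
      by (subst emeasure_density, simp, simp, rule nn_integral_cong_AE, rule AE_I[of _ _ "{0}"])
         (auto simp: indicator_def)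
    also have "\<dots> = ennreal (unit_ball_vol (real n) * (max 0 r) ^ n - unit_ball_vol (real n) * 0 ^ n)"
      by (rule nn_integral_FTC_Icc)
         (use n in \<open>auto intro!: derivative_eq_intros mult_nonneg_nonneg\<close>)
    finally show ?thesis using n by (simp add: zero_power)
  qed
  show "\<And>X. X \<in> range atMost \<Longrightarrow> emeasure ?M X = emeasure ?N X"
    using M N by auto
  show "(\<Union>i. {..real i}) = UNIV"
    by (auto intro: real_arch_simple)
  show "\<And>i. emeasure ?M {..real i} \<noteq> \<infinity>"
    by (simp add: M)
qed auto

text \<open>The surface constant \<open>real n * unit_ball_vol (real n)\<close> is nonzero and
  therefore drops out of the criterion.\<close>

lemma polar_integrable:
  assumes n: "n \<ge> 1" and G: "G \<in> borel_measurable borel"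
  shows "integrable (PiM {..<n} (\<lambda>_. lborel)) (\<lambda>x. G (L2_set x {..<n}))
     \<longleftrightarrow> integrable lborel (\<lambda>r. indicator {0<..} r * (r ^ (n - 1) * G r :: real))"
proof -
  have meas: "(\<lambda>x. L2_set x {..<n}) \<in> borel_measurable (PiM {..<n} (\<lambda>_. lborel))"
    unfolding L2_set_def by measurable
  have "integrable (PiM {..<n} (\<lambda>_. lborel)) (\<lambda>x. G (L2_set x {..<n})) \<longleftrightarrow>
     integrable (distr (PiM {..<n} (\<lambda>_. lborel)) borel (\<lambda>x. L2_set x {..<n})) G"
    by (rule integrable_distr_eq[OF meas G, symmetric])
  also have "\<dots> \<longleftrightarrow> integrable lborel (\<lambda>r. (indicator {0<..} r * (real n * unit_ball_vol (real n) * r ^ (n - 1))) * G r)"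
    unfolding norm_distr_density[OF n]
    by (subst integrable_density) (use G in \<open>auto intro!: AE_I2 simp: indicator_def\<close>)
  also have "(\<lambda>r. (indicator {0<..} r * (real n * unit_ball_vol (real n) * r ^ (n - 1))) * G r)
     = (\<lambda>r. (real n * unit_ball_vol (real n)) * (indicator {0<..} r * (r ^ (n - 1) * G r)))"
    by (auto simp: fun_eq_iff)
  also have "integrable lborel \<dots> \<longleftrightarrow> integrable lborel (\<lambda>r. indicator {0<..} r * (r ^ (n - 1) * G r))"
    using n unit_ball_vol_pos[of "real n", THEN less_imp_neq] by (subst integrable_mult_left_iff) auto
  finally show ?thesis .
qed

lemma polar_integral:
  assumes n: "n \<ge> 1" and G: "G \<in> borel_measurable borel"
  shows "(LINT x|PiM {..<n} (\<lambda>_. lborel). G (L2_set x {..<n}))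
     = real n * unit_ball_vol (real n) * (LINT r|lborel. indicator {0<..} r * (r ^ (n - 1) * G r))"
proof -
  have meas: "(\<lambda>x. L2_set x {..<n}) \<in> borel_measurable (PiM {..<n} (\<lambda>_. lborel))"
    unfolding L2_set_def by measurable
  have "(LINT x|PiM {..<n} (\<lambda>_. lborel). G (L2_set x {..<n})) =
     integral\<^sup>L (distr (PiM {..<n} (\<lambda>_. lborel)) borel (\<lambda>x. L2_set x {..<n})) G"
    by (rule integral_distr[OF meas G, symmetric])
  also have "\<dots> = (LINT r|lborel. (indicator {0<..} r * (real n * unit_ball_vol (real n) * r ^ (n - 1))) * G r)"
    unfolding norm_distr_density[OF n]
    by (subst integral_density) (use G in \<open>auto intro!: AE_I2 simp: indicator_def\<close>)
  also have "(\<lambda>r. (indicator {0<..} r * (real n * unit_ball_vol (real n) * r ^ (n - 1))) * G r)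
     = (\<lambda>r. (real n * unit_ball_vol (real n)) * (indicator {0<..} r * (r ^ (n - 1) * G r)))"
    by (auto simp: fun_eq_iff)
  finally show ?thesis by simp
qed

section \<open>Smooth functions of one real variable\<close>

text \<open>Iterating \<open>deriv\<close> lets the closure properties go by induction on the order
  with the function generalised. When all orders are required, continuity of each derivative comes
  from the next order.\<close>

primrec diff_upto :: "nat \<Rightarrow> real set \<Rightarrow> (real \<Rightarrow> real) \<Rightarrow> bool" where
  "diff_upto 0 S f \<longleftrightarrow> True"
| "diff_upto (Suc k) S f \<longleftrightarrow> (\<forall>x\<in>S. f differentiable at x) \<and> diff_upto k S (deriv f)"

definition smooth_on :: "real set \<Rightarrow> (real \<Rightarrow> real) \<Rightarrow> bool" where
  "smooth_on S f \<longleftrightarrow> (\<forall>k. diff_upto k S f)"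

lemma deriv_cong_open:
  assumes "open S" "x \<in> S" "\<And>y. y \<in> S \<Longrightarrow> f y = g y"
  shows "deriv f x = deriv g x"
  by (intro deriv_cong_ev refl eventually_mono[OF eventually_nhds_in_open[OF assms(1,2)]] assms(3))

lemma diff_upto_cong:
  assumes "open S" "\<And>y. y \<in> S \<Longrightarrow> f y = g y"
  shows "diff_upto k S f \<longleftrightarrow> diff_upto k S g"
  using assms(2)
proof (induction k arbitrary: f g)
  case (Suc k)
  have "f differentiable at x \<longleftrightarrow> g differentiable at x" if "x \<in> S" for x
    using has_field_derivative_transform_within_open[OF _ assms(1) that, of f _ g]
      has_field_derivative_transform_within_open[OF _ assms(1) that, of g _ f] Suc.prems
    unfolding real_differentiable_def by auto
  moreover have "diff_upto k S (deriv f) \<longleftrightarrow> diff_upto k S (deriv g)"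
    using deriv_cong_open[OF assms(1)] Suc.prems by (intro Suc.IH) blast
  ultimately show ?case by simp
qed simp

text \<open>An explicit formula \<open>f'\<close> replaces \<open>deriv f\<close> in the inductions.
  The two agree only on \<open>S\<close>, and openness of \<open>S\<close> makes that enough for the
  higher derivatives.\<close>

lemma diff_upto_SucI:
  assumes "open S" "\<And>x. x \<in> S \<Longrightarrow> (f has_real_derivative f' x) (at x)" "diff_upto k S f'"
  shows "diff_upto (Suc k) S f"
proof -
  have "diff_upto k S (deriv f)"
    using diff_upto_cong[OF assms(1), of "deriv f" f' k] assms(2,3) DERIV_imp_deriv by blast
  then show ?thesis using assms(2) by (auto simp: real_differentiable_def)
qed

lemma diff_upto_SucD: "diff_upto (Suc k) S f \<Longrightarrow> diff_upto k S f"
  by (induction k arbitrary: f) auto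

lemma diff_upto_deriv: "diff_upto (Suc k) S f \<Longrightarrow> x \<in> S \<Longrightarrow> (f has_real_derivative deriv f x) (at x)"
  by (simp add: DERIV_deriv_iff_real_differentiable)

lemma diff_upto_const: "open S \<Longrightarrow> diff_upto k S (\<lambda>x. c)"
proof (induction k arbitrary: c)
  case (Suc k)
  show ?case by (rule diff_upto_SucI[OF \<open>open S\<close>, where f'="\<lambda>_. 0"]) (auto intro: Suc)
qed simp

lemma diff_upto_ident: "open S \<Longrightarrow> diff_upto k S (\<lambda>x. x)"
  by (cases k) (auto intro!: diff_upto_SucI[where f'="\<lambda>_. 1"] diff_upto_const simp del: diff_upto.simps(2))

lemma diff_upto_add:
  assumes "open S" shows "diff_upto k S f \<Longrightarrow> diff_upto k S g \<Longrightarrow> diff_upto k S (\<lambda>x. f x + g x)"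
proof (induction k arbitrary: f g)
  case (Suc k)
  show ?case
    by (rule diff_upto_SucI[OF assms DERIV_add[OF diff_upto_deriv[OF Suc.prems(1)] diff_upto_deriv[OF Suc.prems(2)]]])
       (use Suc in auto)
qed simp

lemma diff_upto_mult:
  assumes "open S" shows "diff_upto k S f \<Longrightarrow> diff_upto k S g \<Longrightarrow> diff_upto k S (\<lambda>x. f x * g x)"
proof (induction k arbitrary: f g)
  case (Suc k)
  show ?case
  proof (rule diff_upto_SucI[OF assms DERIV_mult[OF diff_upto_deriv[OF Suc.prems(1)] diff_upto_deriv[OF Suc.prems(2)]]])
    show "diff_upto k S (\<lambda>x. deriv f x * g x + deriv g x * f x)"
      by (rule diff_upto_add[OF assms Suc.IH Suc.IH])
         (use Suc.prems in \<open>simp_all add: diff_upto_SucD del: diff_upto.simps\<close>, simp_all)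
  qed
qed simp

lemma diff_upto_compose:
  assumes "open S" "open T"
  shows "diff_upto k T f \<Longrightarrow> diff_upto k S g \<Longrightarrow> (\<And>x. x \<in> S \<Longrightarrow> g x \<in> T) \<Longrightarrow> diff_upto k S (\<lambda>x. f (g x))"
proof (induction k arbitrary: f)
  case (Suc k)
  show ?case
  proof (rule diff_upto_SucI[OF assms(1), where f'="\<lambda>x. deriv f (g x) * deriv g x"])
    show "diff_upto k S (\<lambda>x. deriv f (g x) * deriv g x)"
      by (rule diff_upto_mult[OF assms(1) Suc.IH])
         (use Suc.prems in \<open>simp_all add: diff_upto_SucD del: diff_upto.simps\<close>, simp_all)
    show "((\<lambda>x. f (g x)) has_real_derivative deriv f (g x) * deriv g x) (at x)" if "x \<in> S" for x
      using DERIV_chain2[OF diff_upto_deriv[OF Suc.prems(1)] diff_upto_deriv[OF Suc.prems(2)]] that Suc.prems(3) by blast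
  qed
qed simp

lemma diff_upto_inverse: "diff_upto k (- {0}) (inverse :: real \<Rightarrow> real)"
proof (induction k)
  case (Suc k)
  have o: "open (- {0::real})" by auto
  show ?case
  proof (rule diff_upto_SucI[OF o])
    show "diff_upto k (- {0}) (\<lambda>x. (- 1) * (inverse x * inverse x))"
      by (intro diff_upto_mult[OF o] diff_upto_const[OF o] Suc)
  qed (auto intro!: derivative_eq_intros)
qed simp

lemma diff_upto_powr: "diff_upto k {0<..} (\<lambda>x. x powr e)"
proof (induction k arbitrary: e)
  case (Suc k)
  show ?case
    by (rule diff_upto_SucI[where f'="\<lambda>x. e * x powr (e - 1)"])
       (intro diff_upto_mult diff_upto_const Suc open_greaterThan | auto intro!: derivative_eq_intros)+
qed simp

text \<open>Differentiability is demanded in full neighbourhoods, so it can be checked on each set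
  separately. This glues a profile that is smooth for positive argument to a constant piece around
  0.\<close>

lemma diff_upto_Un: "diff_upto k S f \<Longrightarrow> diff_upto k T f \<Longrightarrow> diff_upto k (S \<union> T) f"
  by (induction k arbitrary: f) auto

lemma smooth_on_deriv: "smooth_on S f \<Longrightarrow> smooth_on S (deriv f)"
  unfolding smooth_on_def by (metis diff_upto.simps(2))

lemma smooth_on_has_deriv: "smooth_on S f \<Longrightarrow> x \<in> S \<Longrightarrow> (f has_real_derivative deriv f x) (at x)"
  unfolding smooth_on_def using diff_upto_deriv by blast

lemma smooth_on_cong: "open S \<Longrightarrow> (\<And>y. y \<in> S \<Longrightarrow> f y = g y) \<Longrightarrow> smooth_on S f \<longleftrightarrow> smooth_on S g"
  unfolding smooth_on_def using diff_upto_cong[of S f g] by blast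

lemma smooth_on_const: "open S \<Longrightarrow> smooth_on S (\<lambda>x. c)"
  and smooth_on_ident: "open S \<Longrightarrow> smooth_on S (\<lambda>x. x)"
  and smooth_on_add: "open S \<Longrightarrow> smooth_on S f \<Longrightarrow> smooth_on S g \<Longrightarrow> smooth_on S (\<lambda>x. f x + g x)"
  and smooth_on_mult: "open S \<Longrightarrow> smooth_on S f \<Longrightarrow> smooth_on S g \<Longrightarrow> smooth_on S (\<lambda>x. f x * g x)"
  and smooth_on_compose: "open S \<Longrightarrow> open T \<Longrightarrow> smooth_on T f \<Longrightarrow> smooth_on S g \<Longrightarrow>
     (\<And>x. x \<in> S \<Longrightarrow> g x \<in> T) \<Longrightarrow> smooth_on S (\<lambda>x. f (g x))"
  and smooth_on_inverse: "smooth_on (- {0}) (inverse :: real \<Rightarrow> real)"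
  and smooth_on_powr: "smooth_on {0<..} (\<lambda>x. x powr e)"
  and smooth_on_Un: "smooth_on S f \<Longrightarrow> smooth_on T f \<Longrightarrow> smooth_on (S \<union> T) f"
  unfolding smooth_on_def
  by (simp_all add: diff_upto_const diff_upto_ident diff_upto_add diff_upto_mult diff_upto_compose
      diff_upto_inverse diff_upto_powr diff_upto_Un del: diff_upto.simps)

lemma smooth_on_diff: "open S \<Longrightarrow> smooth_on S f \<Longrightarrow> smooth_on S g \<Longrightarrow> smooth_on S (\<lambda>x. f x - g x)"
  using smooth_on_add[of S f "\<lambda>x. (-1) * g x"] smooth_on_mult[of S "\<lambda>_. -1" g] smooth_on_const[of S "-1"]
  by simp

lemma smooth_on_divide:
  assumes "open S" "smooth_on S f" "smooth_on S g" "\<And>x. x \<in> S \<Longrightarrow> g x \<noteq> 0"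
  shows "smooth_on S (\<lambda>x. f x / g x)"
proof -
  have "smooth_on S (\<lambda>x. f x * inverse (g x))"
    using assms by (intro smooth_on_mult smooth_on_compose[OF _ _ smooth_on_inverse]) auto
  then show ?thesis by (simp add: divide_inverse)
qed

section \<open>A smooth step function\<close>

definition flat_exp :: "nat \<Rightarrow> real \<Rightarrow> real" where
  "flat_exp p x = (if x \<le> 0 then 0 else (1 / x) ^ p * exp (- (1 / x)))"

lemma flat_exp_tendsto_0: "(flat_exp p \<longlongrightarrow> 0) (at 0)"
proof -
  have "((\<lambda>y::real. y ^ p / exp y) \<longlongrightarrow> 0) at_top"
    by (rule tendsto_power_div_exp_0)
  then have "((\<lambda>x::real. (inverse x) ^ p / exp (inverse x)) \<longlongrightarrow> 0) (at_right 0)"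
    by (rule filterlim_compose) (rule filterlim_inverse_at_top_right)
  moreover have "\<forall>\<^sub>F x in at_right 0. (inverse x) ^ p / exp (inverse x) = flat_exp p x"
    by (rule eventually_at_rightI[of 0 1]) (auto simp: flat_exp_def exp_minus field_simps)
  ultimately have "(flat_exp p \<longlongrightarrow> 0) (at_right 0)"
    by (rule Lim_transform_eventually)
  moreover have "(flat_exp p \<longlongrightarrow> 0) (at_left 0)"
    by (rule tendsto_eventually, rule eventually_at_leftI[of "-1" 0]) (auto simp: flat_exp_def)
  ultimately show ?thesis
    by (simp add: filterlim_split_at)
qed

lemma flat_exp_deriv_aux:
  assumes "x > 0"
  shows "((\<lambda>y. (1 / y) ^ p * exp (- (1 / y))) has_real_derivative
     (- real p * (1 / x) ^ Suc p + (1 / x) ^ (p + 2)) * exp (- (1 / x))) (at x)"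
proof -
  \<comment> \<open>The power rule produces the truncated exponent p - 1; the factor p keeps the
    formula right at p = 0.\<close>
  have "real p * (1 / x) ^ (p - Suc 0) * (1 / x) ^ 2 = real p * (1 / x) ^ Suc p"
    by (cases p) (simp_all add: power2_eq_square)
  then show ?thesis
    using assms
    by (auto intro!: derivative_eq_intros simp: power2_eq_square divide_inverse algebra_simps)
qed

text \<open>The powers of 1/x make the family closed under differentiation up to linear
  combinations, so smoothness follows by induction for all p at once. At 0 the difference quotient
  of \<open>flat_exp p\<close> is \<open>flat_exp (Suc p)\<close>, which tends to 0.\<close>

lemma flat_exp_deriv:
  "(flat_exp p has_real_derivative (- real p * flat_exp (Suc p) x + flat_exp (p + 2) x)) (at x)"
proof (rule linorder_cases[of x 0])
  assume "x < 0"
  then have ev: "\<forall>\<^sub>F y in nhds x. flat_exp p y = (\<lambda>_. 0) y"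
    by (intro eventually_nhds_in_open[of "{..<0}", THEN eventually_mono]) (auto simp: flat_exp_def)
  show ?thesis using \<open>x < 0\<close>
    by (subst DERIV_cong_ev[OF refl ev refl]) (auto simp: flat_exp_def)
next
  assume "x > 0"
  then have ev: "\<forall>\<^sub>F y in nhds x. flat_exp p y = (1 / y) ^ p * exp (- (1 / y))"
    by (intro eventually_nhds_in_open[of "{0<..}", THEN eventually_mono]) (auto simp: flat_exp_def)
  show ?thesis using \<open>x > 0\<close>
    unfolding DERIV_cong_ev[OF refl ev refl]
    by (rule flat_exp_deriv_aux[THEN DERIV_cong]) (use \<open>x > 0\<close> in \<open>simp_all add: flat_exp_def algebra_simps\<close>)
next
  assume x: "x = 0"
  have "((\<lambda>h. (flat_exp p (0 + h) - flat_exp p 0) / h) \<longlongrightarrow> 0) (at 0)"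
    by (rule Lim_transform_eventually[OF flat_exp_tendsto_0[of "Suc p"]])
       (auto simp: eventually_at_filter flat_exp_def)
  then show ?thesis unfolding x DERIV_def by (simp add: flat_exp_def)
qed

lemma smooth_on_flat_exp: "smooth_on UNIV (flat_exp p)"
proof -
  have "diff_upto k UNIV (flat_exp p)" for k
  proof (induction k arbitrary: p)
    case (Suc k)
    show ?case
      by (rule diff_upto_SucI[OF open_UNIV flat_exp_deriv])
         (intro diff_upto_add diff_upto_mult diff_upto_const Suc open_UNIV)
  qed simp
  then show ?thesis by (simp add: smooth_on_def)
qed

definition smooth_step :: "real \<Rightarrow> real" where
  "smooth_step x = flat_exp 0 (x - 1) / (flat_exp 0 (x - 1) + flat_exp 0 (2 - x))"

lemma smooth_step_0: "x \<le> 1 \<Longrightarrow> smooth_step x = 0"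
  and smooth_step_1: "x \<ge> 2 \<Longrightarrow> smooth_step x = 1"
  by (auto simp: smooth_step_def flat_exp_def)

text \<open>At least one of x - 1 and 2 - x is positive, so the denominator never vanishes.\<close>

lemma smooth_on_smooth_step: "smooth_on UNIV smooth_step"
proof -
  have "flat_exp 0 (x - 1) + flat_exp 0 (2 - x) \<noteq> 0" for x
    using exp_gt_zero[of "- (1 / (x - 1))"] exp_gt_zero[of "- (1 / (2 - x))"]
    by (auto simp: flat_exp_def simp del: exp_gt_zero intro!: less_imp_neq[THEN not_sym] add_pos_pos)
  then show ?thesis
    unfolding smooth_step_def[abs_def]
    by (intro smooth_on_divide smooth_on_add smooth_on_compose[OF open_UNIV open_UNIV smooth_on_flat_exp]
        smooth_on_diff smooth_on_ident smooth_on_const) auto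
qed

section \<open>Kummer's equation\<close>

text \<open>The coefficients of Kummer's function M(a, c, -s), the confluent hypergeometric series
  1F1(a; c; -s). Reflecting the argument turns z w'' + (c - z) w' - a w = 0 into s g'' + (c + s) g'
  + a g = 0.\<close>

definition kummer_fps :: "real \<Rightarrow> real \<Rightarrow> real fps" where
  "kummer_fps a c = Abs_fps (\<lambda>k. (-1) ^ k * pochhammer a k / (pochhammer c k * fact k))"

lemma kummer_nth_Suc:
  assumes "c > 0"
  shows "real (Suc k) * (c + real k) * fps_nth (kummer_fps a c) (Suc k) = - (a + real k) * fps_nth (kummer_fps a c) k"
proof -
  have "pochhammer c k > 0" "c + real k > 0"
    using assms by (auto intro: pochhammer_pos)
  then show ?thesis
    by (simp add: kummer_fps_def pochhammer_rec' del: of_nat_Suc) (simp add: divide_simps, simp add: algebra_simps)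
qed

text \<open>For 0 < a < c the quotient of the Pochhammer symbols is at most 1, so the exponential
  series dominates.\<close>

lemma kummer_conv_radius:
  assumes "0 < a" "a < c"
  shows "fps_conv_radius (kummer_fps a c) = \<infinity>"
  unfolding fps_conv_radius_def
proof (rule conv_radius_inftyI'')
  fix z :: real
  have le: "pochhammer a k \<le> pochhammer c k" for k
    using assms by (induction k) (auto simp: pochhammer_rec' intro!: mult_mono pochhammer_nonneg)
  have "norm (fps_nth (kummer_fps a c) k * z ^ k) \<le> inverse (fact k) * \<bar>z\<bar> ^ k" for k
  proof -
    have "pochhammer a k > 0" "pochhammer c k > 0"
      using assms by (auto intro: pochhammer_pos)
    then have "\<bar>fps_nth (kummer_fps a c) k\<bar> \<le> inverse (fact k)"
      using le[of k] by (simp add: kummer_fps_def abs_mult field_simps)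
    then show ?thesis
      by (simp add: abs_mult power_abs mult_right_mono)
  qed
  then show "summable (\<lambda>k. fps_nth (kummer_fps a c) k * z ^ k)"
    by (rule summable_comparison_test'[OF summable_exp, rotated]) 
qed

lemma smooth_on_eval_fps:
  fixes F :: "real fps"
  assumes "fps_conv_radius F = \<infinity>"
  shows "smooth_on UNIV (eval_fps F)"
proof -
  have "diff_upto k UNIV (eval_fps F)" for k
    using assms
  proof (induction k arbitrary: F)
    case (Suc k)
    have "fps_conv_radius (fps_deriv F) = \<infinity>"
      using fps_conv_radius_deriv[of F] Suc.prems by simp
    with Suc show ?case
      by (intro diff_upto_SucI[OF open_UNIV has_field_derivative_eval_fps]) auto
  qed simp
  then show ?thesis by (simp add: smooth_on_def)
qed

text \<open>The equation is the coefficient recurrence \<open>kummer_nth_Suc\<close> written as an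
  identity of formal power series. Evaluation respects sums and products because all the series
  involved are entire.\<close>

lemma kummer_ode:
  assumes "0 < a" "a < c"
  defines "F \<equiv> kummer_fps a c"
  shows "s * eval_fps (fps_deriv (fps_deriv F)) s + (c + s) * eval_fps (fps_deriv F) s + a * eval_fps F s = 0"
proof -
  have r: "fps_conv_radius F = \<infinity>"
    unfolding F_def by (rule kummer_conv_radius[OF assms(1,2)])
  have r1: "fps_conv_radius (fps_deriv F) = \<infinity>"
    using fps_conv_radius_deriv[of F] r by simp
  have r2: "fps_conv_radius (fps_deriv (fps_deriv F)) = \<infinity>"
    using fps_conv_radius_deriv[of "fps_deriv F"] r1 by simp
  have rx: "fps_conv_radius (fps_X * G) = \<infinity>" if "fps_conv_radius G = \<infinity>" for G :: "real fps"
    using fps_conv_radius_mult[of fps_X G] that by simp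
  have rc: "fps_conv_radius (fps_const d * G) = \<infinity>" if "fps_conv_radius G = \<infinity>" for G :: "real fps" and d
    using fps_conv_radius_mult[of "fps_const d" G] that by simp
  have radd: "fps_conv_radius (G + G') = \<infinity>" if "fps_conv_radius G = \<infinity>" "fps_conv_radius G' = \<infinity>" for G G' :: "real fps"
    using fps_conv_radius_add[of G G'] that by simp
  let ?L = "fps_X * fps_deriv (fps_deriv F) + fps_const c * fps_deriv F + fps_X * fps_deriv F + fps_const a * F"
  have "fps_nth ?L k = 0" for k
  proof (cases k)
    case 0
    then show ?thesis using kummer_nth_Suc[of c 0 a] assms by simp
  next
    case (Suc j)
    then show ?thesis using kummer_nth_Suc[of c k a] assms
      by (simp add: algebra_simps)
  qed
  then have "?L = 0" by (simp add: fps_eq_iff)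
  then have "eval_fps ?L s = 0" by simp
  also have "eval_fps ?L s = s * eval_fps (fps_deriv (fps_deriv F)) s + c * eval_fps (fps_deriv F) s
      + s * eval_fps (fps_deriv F) s + a * eval_fps F s"
    by (simp add: eval_fps_add eval_fps_mult r r1 r2 rx rc radd)
  finally show ?thesis by (simp add: algebra_simps)
qed

text \<open>
  With \<open>y = s g' + a g\<close>, the function \<open>V = s\<^sup>2\<^sup>a (g\<^sup>2 + y\<^sup>2)\<close> satisfies \<open>V' \<le> C V / s\<^sup>2\<close> for large \<open>s\<close>, so that
  \<open>V exp (C / s)\<close> is eventually nonincreasing and \<open>V\<close> stays bounded.
\<close>

lemma kummer_decay:
  fixes g g' g'' :: "real \<Rightarrow> real"
  assumes g: "\<And>s. s > 0 \<Longrightarrow> (g has_real_derivative g' s) (at s)"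
    and g': "\<And>s. s > 0 \<Longrightarrow> (g' has_real_derivative g'' s) (at s)"
    and ode: "\<And>s. s > 0 \<Longrightarrow> s * g'' s + (c + s) * g' s + a * g s = 0"
  shows "\<exists>K. \<forall>s\<ge>1. \<bar>g s\<bar> \<le> K * s powr (- a) \<and> \<bar>s * g' s\<bar> \<le> K * s powr (- a)"
proof -
  \<comment> \<open>In terms of g and y the equation is the system g' = (y - a g)/s, y' = -y + (1 +
    a - c) y/s - q g/s. Differentiating the weight s^(2a) cancels the g^2 term of V' and adds a to
    the coefficient of y/s, which produces p.\<close>
  define p where "p = 1 + 2 * a - c"
  define q where "q = a * (1 + a - c)"
  \<comment> \<open>Beyond this point p/s is at most 1/2. The damping term -2 y^2 is then spent in
    equal parts on the p term and on the mixed term, the latter by 2xy \<le> x^2 + y^2, and only (1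
    - q)^2 g^2 / s^2 survives; this is the origin of C.\<close>
  define s0 where "s0 = max 1 (2 * \<bar>p\<bar>)"
  define y where "y s = s * g' s + a * g s" for s
  define V where "V s = (s powr a)\<^sup>2 * ((g s)\<^sup>2 + (y s)\<^sup>2)" for s
  define V' where "V' s = (s powr a)\<^sup>2 * (2 * (g s * y s / s + y s * (- y s + p * y s / s - q * g s / s)))" for s
  define C where "C = (1 - q)\<^sup>2"
  have dV: "(V has_real_derivative V' s) (at s)" if "s > 0" for s
  proof -
    have eq: "s * g'' s = - (c + s) * g' s - a * g s" using ode[OF that] by (simp add: algebra_simps)
    have g's: "g' s = (y s - a * g s) / s" using that by (simp add: y_def)
    have "(y has_real_derivative (g' s + s * g'' s + a * g' s)) (at s)"
      unfolding y_def using that by (auto intro!: derivative_eq_intros g g')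
    also have "g' s + s * g'' s + a * g' s = (1 + a - c) * ((y s - a * g s) / s) - y s"
      unfolding eq using that by (simp add: y_def field_simps)
    finally have dy: "(y has_real_derivative \<dots>) (at s)" .
    have dg: "(g has_real_derivative (y s - a * g s) / s) (at s)" using g[OF that] g's by simp
    have dp: "((\<lambda>s. (s powr a)\<^sup>2) has_real_derivative 2 * a * (s powr a)\<^sup>2 / s) (at s)"
      using that by (auto intro!: derivative_eq_intros simp: powr_diff power2_eq_square)
    show ?thesis
      unfolding V_def
      by (rule DERIV_cong[OF DERIV_mult[OF dp DERIV_add[OF DERIV_power[OF dg, of 2] DERIV_power[OF dy, of 2]]]])
        (use that in \<open>simp add: V'_def p_def q_def power2_eq_square field_simps\<close>)
  qed
  have V'_le: "V' s \<le> C / s\<^sup>2 * V s" if "s \<ge> s0" for s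
  proof -
    have s: "s \<ge> 1" "2 * \<bar>p\<bar> \<le> s" using that by (auto simp: s0_def)
    have "p / s \<le> 1 / 2" using s by (simp add: field_simps)
    then have "p * y s * y s / s \<le> (y s)\<^sup>2 / 2"
      using mult_right_mono[of "p / s" "1 / 2" "(y s)\<^sup>2"] by (simp add: power2_eq_square mult_ac)
    moreover have "2 * ((1 - q) * g s / s) * y s \<le> ((1 - q) * g s / s)\<^sup>2 + (y s)\<^sup>2"
      using sum_squares_bound[of "(1 - q) * g s / s" "y s"] by simp
    moreover have "2 * (g s * y s / s + y s * (- y s + p * y s / s - q * g s / s))
        = 2 * ((1 - q) * g s / s) * y s + 2 * (p * y s * y s / s) - 2 * (y s)\<^sup>2"
      by (simp add: power2_eq_square algebra_simps diff_divide_distrib add_divide_distrib)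
    ultimately have "2 * (g s * y s / s + y s * (- y s + p * y s / s - q * g s / s)) \<le> ((1 - q) * g s / s)\<^sup>2"
      by linarith
    also have "\<dots> = C / s\<^sup>2 * (g s)\<^sup>2"
      by (simp add: C_def power_divide power_mult_distrib)
    also have "\<dots> \<le> C / s\<^sup>2 * ((g s)\<^sup>2 + (y s)\<^sup>2)"
      by (intro mult_left_mono) (auto simp: C_def)
    finally have "(s powr a)\<^sup>2 * (2 * (g s * y s / s + y s * (- y s + p * y s / s - q * g s / s)))
        \<le> (s powr a)\<^sup>2 * (C / s\<^sup>2 * ((g s)\<^sup>2 + (y s)\<^sup>2))"
      by (rule mult_left_mono) simp
    then show ?thesis by (simp only: V'_def V_def mult_ac)
  qed
  have s0: "s0 \<ge> 1" by (simp add: s0_def)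
  have "V s * exp (C / s) \<le> V s0 * exp (C / s0)" if "s \<ge> s0" for s
  proof (rule DERIV_nonpos_imp_nonincreasing[OF that])
    fix x assume x: "s0 \<le> x" "x \<le> s"
    have "((\<lambda>s. V s * exp (C / s)) has_real_derivative (V' x - C / x\<^sup>2 * V x) * exp (C / x)) (at x)"
      using x s0 by (auto intro!: derivative_eq_intros dV simp: power2_eq_square field_simps)
    moreover have "(V' x - C / x\<^sup>2 * V x) * exp (C / x) \<le> 0"
      using V'_le[OF x(1)] by (simp add: mult_nonpos_nonneg)
    ultimately show "\<exists>y. ((\<lambda>s. V s * exp (C / s)) has_real_derivative y) (at x) \<and> y \<le> 0" by blast
  qed
  moreover have "V s \<le> V s * exp (C / s)" if "s \<ge> s0" for s
  proof -
    have "exp (C / s) \<ge> 1" "V s \<ge> 0" using that s0 by (auto simp: C_def V_def)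
    then show ?thesis by (simp add: mult_le_cancel_left1)
  qed
  ultimately have tail: "V s \<le> V s0 * exp (C / s0)" if "s \<ge> s0" for s
    using that by (meson order_trans)
  have "continuous_on {1..s0} V"
    by (intro DERIV_continuous_on[where D=V']) (auto intro!: has_field_derivative_at_within dV)
  then obtain B where B: "\<And>s. s \<in> {1..s0} \<Longrightarrow> V s \<le> B"
    using continuous_attains_sup[of "{1..s0}" V] s0 by fastforce
  define M where "M = sqrt (max B (V s0 * exp (C / s0)))"
  have VM: "V s \<le> M\<^sup>2" if "s \<ge> 1" for s
  proof -
    have "V s \<le> max B (V s0 * exp (C / s0))"
      using B[of s] tail[of s] that by (cases "s \<ge> s0") (auto simp: le_max_iff_disj)
    moreover have "V s \<ge> 0" by (auto simp: V_def)
    ultimately show ?thesis unfolding M_def by simp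
  qed
  have M0: "M \<ge> 0"
    unfolding M_def using VM[of 1] tail[of s0] by (auto simp: V_def le_max_iff_disj)
  have bd: "\<bar>g s\<bar> \<le> M * s powr (- a) \<and> \<bar>y s\<bar> \<le> M * s powr (- a)" if "s \<ge> 1" for s
  proof -
    have "(s powr a * \<bar>g s\<bar>)\<^sup>2 \<le> V s" "(s powr a * \<bar>y s\<bar>)\<^sup>2 \<le> V s"
      by (auto simp: V_def power_mult_distrib algebra_simps)
    then have "s powr a * \<bar>g s\<bar> \<le> M" "s powr a * \<bar>y s\<bar> \<le> M"
      using VM[OF that] M0 by (meson order_trans power2_le_imp_le)+
    then show ?thesis using that by (simp add: powr_minus field_simps)
  qed
  show ?thesis
  proof (intro exI[of _ "(1 + \<bar>a\<bar>) * M"] allI impI conjI)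
    fix s :: real assume s: "s \<ge> 1"
    let ?w = "M * s powr (- a)"
    have w: "?w \<ge> 0" using M0 by simp
    have "\<bar>a * g s\<bar> \<le> \<bar>a\<bar> * ?w" using bd[OF s] by (simp only: abs_mult mult_left_mono abs_ge_zero)
    then have "\<bar>s * g' s\<bar> \<le> ?w + \<bar>a\<bar> * ?w"
      using bd[OF s] unfolding y_def by linarith
    then show "\<bar>s * g' s\<bar> \<le> (1 + \<bar>a\<bar>) * M * s powr (- a)" by (simp add: algebra_simps)
    have "?w \<le> (1 + \<bar>a\<bar>) * ?w" using mult_right_mono[OF _ w, of 1 "1 + \<bar>a\<bar>"] by simp
    then show "\<bar>g s\<bar> \<le> (1 + \<bar>a\<bar>) * M * s powr (- a)" using bd[OF s] by (simp add: mult_ac)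
  qed
qed

section \<open>Radial functions\<close>

lemma Rn_fun_upd: "x \<in> Rn n \<Longrightarrow> i < n \<Longrightarrow> x(i := t) \<in> Rn n"
  by (auto simp: Rn_def PiE_def extensional_def)

lemma sum_sq_fun_upd:
  fixes x :: "nat \<Rightarrow> real"
  assumes "i < n"
  shows "(\<Sum>j<n. ((x(i := t)) j)\<^sup>2) = t\<^sup>2 + (\<Sum>j\<in>{..<n} - {i}. (x j)\<^sup>2)"
proof -
  have "(\<Sum>j<n. ((x(i := t)) j)\<^sup>2) = ((x(i := t)) i)\<^sup>2 + (\<Sum>j\<in>{..<n} - {i}. ((x(i := t)) j)\<^sup>2)"
    using assms by (intro sum.remove) auto
  also have "(\<Sum>j\<in>{..<n} - {i}. ((x(i := t)) j)\<^sup>2) = (\<Sum>j\<in>{..<n} - {i}. (x j)\<^sup>2)"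
    by (intro sum.cong) auto
  finally show ?thesis by simp
qed

lemma L2_set_fun_upd:
  fixes x :: "nat \<Rightarrow> real"
  assumes "i < n"
  shows "L2_set (x(i := t)) {..<n} = sqrt (t\<^sup>2 + (\<Sum>j\<in>{..<n} - {i}. (x j)\<^sup>2))"
  unfolding L2_set_def sum_sq_fun_upd[OF assms] ..

lemma L2_set_upd_has_deriv:
  fixes x :: "nat \<Rightarrow> real"
  assumes "i < n" "L2_set x {..<n} \<noteq> 0"
  shows "((\<lambda>t. L2_set (x(i := t)) {..<n}) has_real_derivative x i / L2_set x {..<n}) (at (x i))"
proof -
  define q where "q = (\<Sum>j\<in>{..<n} - {i}. (x j)\<^sup>2)"
  have L: "L2_set (x(i := t)) {..<n} = sqrt (t\<^sup>2 + q)" for t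
    unfolding q_def by (rule L2_set_fun_upd[OF assms(1)])
  have x: "L2_set x {..<n} = sqrt ((x i)\<^sup>2 + q)"
    using L[of "x i"] by simp
  moreover have "q \<ge> 0" unfolding q_def by (rule sum_nonneg) simp
  ultimately have "(x i)\<^sup>2 + q > 0"
    using assms(2) by (metis add_nonneg_nonneg less_eq_real_def real_sqrt_zero zero_le_power2)
  then show ?thesis unfolding L x
    by (auto intro!: derivative_eq_intros simp: field_simps)
qed

lemma radial_has_partial_deriv:
  assumes "i < n" "x \<in> Rn n" "L2_set x {..<n} \<noteq> 0"
    and u: "\<And>y. y \<in> Rn n \<Longrightarrow> u y = f (L2_set y {..<n})"
    and f: "(f has_real_derivative d) (at (L2_set x {..<n}))"
  shows "((\<lambda>t. u (x(i := t))) has_real_derivative d * (x i / L2_set x {..<n})) (at (x i))"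
proof -
  have "(\<lambda>t. u (x(i := t))) = (\<lambda>t. f (L2_set (x(i := t)) {..<n}))"
    using u Rn_fun_upd[OF assms(2,1)] by auto
  moreover have "((\<lambda>t. f (L2_set (x(i := t)) {..<n})) has_real_derivative d * (x i / L2_set x {..<n})) (at (x i))"
    by (rule DERIV_chain2[OF _ L2_set_upd_has_deriv[OF assms(1,3)]]) (use f in simp)
  ultimately show ?thesis by simp
qed

lemma radial_partial_deriv:
  assumes "i < n" "x \<in> Rn n" "L2_set x {..<n} \<noteq> 0"
    and u: "\<And>y. y \<in> Rn n \<Longrightarrow> u y = f (L2_set y {..<n})"
    and f: "\<And>r. r > 0 \<Longrightarrow> (f has_real_derivative f' r) (at r)"
  shows "partial_deriv i u x = f' (L2_set x {..<n}) / L2_set x {..<n} * x i"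
proof -
  have "L2_set x {..<n} > 0" using assms(3) by (simp add: order_less_le)
  then show ?thesis
    using radial_has_partial_deriv[OF assms(1,2,3) u f]
    by (simp add: partial_deriv_def DERIV_imp_deriv)
qed

lemma radial_partial_deriv2:
  assumes i: "i < n" and x: "x \<in> Rn n" "L2_set x {..<n} \<noteq> 0"
    and u: "\<And>y. y \<in> Rn n \<Longrightarrow> u y = f (L2_set y {..<n})"
    and f: "\<And>r. r > 0 \<Longrightarrow> (f has_real_derivative f' r) (at r)"
    and f': "\<And>r. r > 0 \<Longrightarrow> (f' has_real_derivative f'' r) (at r)"
  defines "r \<equiv> L2_set x {..<n}"
  shows "partial_deriv i (partial_deriv i u) x = (f'' r / r - f' r / r\<^sup>2) * (x i)\<^sup>2 / r + f' r / r"
proof -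
  have r: "r > 0" using x(2) unfolding r_def by (simp add: order_less_le)
  \<comment> \<open>The formula for the first derivative is known only off the origin. Continuity of
    the norm makes it valid for all t near \<open>x i\<close>, and the second \<open>deriv\<close>
    sees nothing else.\<close>
  have ev: "\<forall>\<^sub>F t in nhds (x i). partial_deriv i u (x(i := t)) =
      f' (L2_set (x(i := t)) {..<n}) / L2_set (x(i := t)) {..<n} * t"
  proof -
    have "isCont (\<lambda>t. L2_set (x(i := t)) {..<n}) (x i)"
      using DERIV_isCont L2_set_upd_has_deriv[OF i x(2)] by blast
    then have "((\<lambda>t. L2_set (x(i := t)) {..<n}) \<longlongrightarrow> L2_set (x(i := x i)) {..<n}) (nhds (x i))"
      unfolding isCont_def by (rule tendsto_at_iff_tendsto_nhds[THEN iffD1])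
    then have "((\<lambda>t. L2_set (x(i := t)) {..<n}) \<longlongrightarrow> r) (nhds (x i))"
      by (simp add: r_def)
    then have "\<forall>\<^sub>F t in nhds (x i). L2_set (x(i := t)) {..<n} > 0"
      by (rule order_tendstoD(1)[OF _ r])
    then show ?thesis
    proof (rule eventually_mono)
      fix t assume "L2_set (x(i := t)) {..<n} > 0"
      then show "partial_deriv i u (x(i := t)) =
          f' (L2_set (x(i := t)) {..<n}) / L2_set (x(i := t)) {..<n} * t"
        using radial_partial_deriv[OF i Rn_fun_upd[OF x(1) i] _ u f, of t] by simp
    qed
  qed
  have "((\<lambda>r. f' r / r) has_real_derivative (f'' r / r - f' r / r\<^sup>2)) (at r)"
    using r by (auto intro!: derivative_eq_intros f' simp: power2_eq_square field_simps)
  then have "((\<lambda>t. (\<lambda>y. f' (L2_set y {..<n}) / L2_set y {..<n}) (x(i := t))) has_real_derivative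
      (f'' r / r - f' r / r\<^sup>2) * (x i / r)) (at (x i))"
    unfolding r_def by (intro radial_has_partial_deriv[OF i x]) auto
  from DERIV_mult[OF this DERIV_ident]
  have "((\<lambda>t. f' (L2_set (x(i := t)) {..<n}) / L2_set (x(i := t)) {..<n} * t) has_real_derivative
      (f'' r / r - f' r / r\<^sup>2) * (x i)\<^sup>2 / r + f' r / r) (at (x i))"
    by (rule DERIV_cong) (simp add: power2_eq_square r_def)
  then have "deriv (\<lambda>t. partial_deriv i u (x(i := t))) (x i)
      = (f'' r / r - f' r / r\<^sup>2) * (x i)\<^sup>2 / r + f' r / r"
    using deriv_cong_ev[OF ev refl] DERIV_imp_deriv by simp
  then show ?thesis by (simp add: partial_deriv_def[of i "partial_deriv i u"])
qed

lemma sum_sq_L2_set: "(\<Sum>i<n. (x i)\<^sup>2) = (L2_set x {..<n})\<^sup>2"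
  by (simp add: L2_set_def sum_nonneg)

lemma radial_grad_norm_sq:
  assumes "x \<in> Rn n" "L2_set x {..<n} \<noteq> 0"
    and u: "\<And>y. y \<in> Rn n \<Longrightarrow> u y = f (L2_set y {..<n})"
    and f: "\<And>r. r > 0 \<Longrightarrow> (f has_real_derivative f' r) (at r)"
  shows "grad_norm_sq n u x = (f' (L2_set x {..<n}))\<^sup>2"
proof -
  have "grad_norm_sq n u x = (\<Sum>i<n. (f' (L2_set x {..<n}) / L2_set x {..<n})\<^sup>2 * (x i)\<^sup>2)"
    unfolding grad_norm_sq_def
    by (intro sum.cong) (auto simp: radial_partial_deriv[OF _ assms(1,2) u f] power_mult_distrib power_divide)
  also have "\<dots> = (f' (L2_set x {..<n}))\<^sup>2"
    unfolding sum_distrib_left[symmetric] sum_sq_L2_set using assms(2) by (simp add: power_divide)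
  finally show ?thesis .
qed

lemma radial_laplacian:
  assumes x: "x \<in> Rn n" "L2_set x {..<n} \<noteq> 0"
    and u: "\<And>y. y \<in> Rn n \<Longrightarrow> u y = f (L2_set y {..<n})"
    and f: "\<And>r. r > 0 \<Longrightarrow> (f has_real_derivative f' r) (at r)"
    and f': "\<And>r. r > 0 \<Longrightarrow> (f' has_real_derivative f'' r) (at r)"
  defines "r \<equiv> L2_set x {..<n}"
  shows "laplacian n u x = f'' r + (real n - 1) * f' r / r"
proof -
  have r: "r \<noteq> 0" using x(2) by (simp add: r_def)
  have "laplacian n u x = (\<Sum>i<n. (f'' r / r - f' r / r\<^sup>2) / r * (x i)\<^sup>2 + f' r / r)"
    unfolding laplacian_def r_def
    by (intro sum.cong) (auto simp: radial_partial_deriv2[OF _ x u f f'])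
  also have "\<dots> = (f'' r / r - f' r / r\<^sup>2) / r * r\<^sup>2 + real n * (f' r / r)"
    unfolding sum.distrib sum_distrib_left[symmetric] sum_sq_L2_set r_def by simp
  also have "\<dots> = f'' r + (real n - 1) * f' r / r"
    using r by (simp add: field_simps power2_eq_square)
  finally show ?thesis .
qed

section \<open>The profile of a radial function along the first axis\<close>

definition axis_pt :: "nat \<Rightarrow> real \<Rightarrow> nat \<Rightarrow> real" where
  "axis_pt n t = (\<lambda>i\<in>{..<n}. if i = 0 then t else 0)"

lemma axis_pt_Rn: "axis_pt n t \<in> Rn n"
  by (auto simp: axis_pt_def Rn_def)

lemma axis_pt_0: "n \<ge> 1 \<Longrightarrow> axis_pt n t 0 = t"
  by (simp add: axis_pt_def)

lemma axis_pt_upd: "n \<ge> 1 \<Longrightarrow> (axis_pt n t)(0 := s) = axis_pt n s"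
  by (auto simp: axis_pt_def fun_eq_iff)

lemma L2_set_axis_pt: "n \<ge> 1 \<Longrightarrow> L2_set (axis_pt n t) {..<n} = \<bar>t\<bar>"
proof -
  assume n: "n \<ge> 1"
  have "(\<Sum>i<n. (axis_pt n t i)\<^sup>2) = (\<Sum>i<n. if i = 0 then t\<^sup>2 else 0)"
    by (intro sum.cong) (auto simp: axis_pt_def)
  also have "\<dots> = t\<^sup>2" using n by simp
  finally show ?thesis by (simp add: L2_set_def)
qed

lemma continuous_on_axis_pt: "continuous_on S (axis_pt n)"
proof (rule continuous_on_coordinatewise_then_product)
  fix i
  show "continuous_on S (\<lambda>t. axis_pt n t i)"
    by (cases "i < n"; cases "i = 0") (auto simp: axis_pt_def)
qed

lemma Rn_L2_set_zero: "x \<in> Rn n \<Longrightarrow> L2_set x {..<n} = 0 \<Longrightarrow> x = axis_pt n 0"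
  by (auto simp: Rn_def axis_pt_def PiE_def extensional_def fun_eq_iff L2_set_eq_0_iff)

text \<open>The profile is the restriction of u to the entire first axis, negative half included.
  Its derivatives are therefore two-sided even at 0, and they are the iterated partial derivatives
  of u in coordinate 0, which \<open>smooth_Rn\<close> provides.\<close>

lemma radial_profile:
  assumes n: "n \<ge> 1" and "smooth_Rn n u" "compact_support_Rn n u" "radial_Rn n u"
  obtains f f' f'' R where
    "\<And>x. x \<in> Rn n \<Longrightarrow> u x = f (L2_set x {..<n})"
    "\<And>t. (f has_real_derivative f' t) (at t)"
    "\<And>t. (f' has_real_derivative f'' t) (at t)"
    "continuous_on UNIV f''" "R > 0" "\<And>t. \<bar>t\<bar> \<ge> R \<Longrightarrow> f t = 0"
proof -
  define F where "F j t = (foldr partial_deriv (replicate j 0) u) (axis_pt n t)" for j t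
  have js: "set (replicate j (0::nat)) \<subseteq> {..<n}" for j
    using n by (induction j) simp_all
  have deriv: "(F j has_real_derivative F (Suc j) t) (at t)" for j t
  proof -
    let ?v = "foldr partial_deriv (replicate j 0) u"
    have "(\<lambda>s. ?v ((axis_pt n t)(0 := s))) differentiable at (axis_pt n t 0)"
      using \<open>smooth_Rn n u\<close>[unfolded smooth_Rn_def, rule_format, OF js[of j], THEN conjunct2, rule_format,
          of 0 "axis_pt n t"] n axis_pt_Rn by simp
    then have "F j differentiable at t"
      by (simp add: axis_pt_upd[OF n] axis_pt_0[OF n] F_def[abs_def])
    moreover have "F (Suc j) t = deriv (F j) t"
      by (simp add: F_def[abs_def] partial_deriv_def axis_pt_upd[OF n] axis_pt_0[OF n])
    ultimately show ?thesis by (simp add: DERIV_deriv_iff_real_differentiable)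
  qed
  have cont: "continuous_on UNIV (F 2)"
  proof -
    have "continuous_on (Rn n) (foldr partial_deriv (replicate 2 0) u)"
      using \<open>smooth_Rn n u\<close> js[of 2] unfolding smooth_Rn_def by blast
    then show ?thesis unfolding F_def
      by (rule continuous_on_compose2[OF _ continuous_on_axis_pt]) (auto simp: axis_pt_Rn)
  qed
  have rad: "u x = F 0 (L2_set x {..<n})" if "x \<in> Rn n" for x
  proof -
    have "L2_set x {..<n} = L2_set (axis_pt n (L2_set x {..<n})) {..<n}"
      by (simp add: L2_set_axis_pt[OF n] L2_set_nonneg)
    then show ?thesis
      using \<open>radial_Rn n u\<close>[unfolded radial_Rn_def, rule_format, OF that axis_pt_Rn]
      unfolding F_def by simp
  qed
  define S where "S = {x \<in> Rn n. u x \<noteq> 0}"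
  \<comment> \<open>The profile is read off the first axis, so a bound for coordinate 0 on the
    support is all that has to be extracted from compactness.\<close>
  have "compact ((\<lambda>x. x 0) ` closure S)"
    using assms(3) unfolding compact_support_Rn_def S_def
    by (intro compact_continuous_image continuous_on_subset[OF continuous_on_product_coordinates]) auto
  from compact_imp_bounded[OF this] obtain B
    where "\<forall>y\<in>(\<lambda>x. x 0) ` closure S. norm y \<le> B"
    unfolding bounded_iff by blast
  then have B: "\<bar>x 0\<bar> \<le> B" if "x \<in> closure S" for x
    using that by simp
  have sup: "F 0 t = 0" if "\<bar>t\<bar> \<ge> \<bar>B\<bar> + 1" for t
  proof (rule ccontr)
    assume "F 0 t \<noteq> 0"
    then have "axis_pt n t \<in> S" by (simp add: S_def F_def axis_pt_Rn)
    then show False using B[OF closure_subset[THEN subsetD]] axis_pt_0[OF n, of t] that by force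
  qed
  have d1: "(F 0 has_real_derivative F 1 t) (at t)" and d2: "(F 1 has_real_derivative F 2 t) (at t)" for t
    using deriv[of 0 t] deriv[of 1 t] by (simp_all add: numeral_2_eq_2)
  show ?thesis
    by (rule that[of "F 0" "F 1" "F 2" "\<bar>B\<bar> + 1"]) (use rad d1 d2 cont sup in auto)
qed

text \<open>Unlike the radial functions, the following class is closed under partial derivatives.\<close>

inductive radial_poly :: "nat \<Rightarrow> ((nat \<Rightarrow> real) \<Rightarrow> real) \<Rightarrow> bool" for n where
  radial: "smooth_on UNIV h \<Longrightarrow> radial_poly n (\<lambda>x. h (\<Sum>j<n. (x j)\<^sup>2))"
| coord: "i < n \<Longrightarrow> radial_poly n u \<Longrightarrow> radial_poly n (\<lambda>x. x i * u x)"
| add: "radial_poly n u \<Longrightarrow> radial_poly n v \<Longrightarrow> radial_poly n (\<lambda>x. u x + v x)"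

text \<open>The i-th partial derivative of h(|x|^2) is x_i times 2 h'(|x|^2), with no singularity at
  the origin. This is why the class is built from functions of |x|^2 rather than |x|, together with
  coordinate factors.\<close>

lemma radial_poly_deriv:
  assumes "radial_poly n u" "i < n"
  shows "\<exists>u'. radial_poly n u' \<and> (\<forall>x. ((\<lambda>t. u (x(i := t))) has_real_derivative u' x) (at (x i)))"
  using assms
proof (induction rule: radial_poly.induct)
  case (radial h)
  have s: "smooth_on UNIV (\<lambda>q. 2 * deriv h q)"
    by (intro smooth_on_mult smooth_on_const smooth_on_deriv radial.hyps) auto
  have "((\<lambda>t. h (\<Sum>j<n. ((x(i := t)) j)\<^sup>2)) has_real_derivative x i * (2 * deriv h (\<Sum>j<n. (x j)\<^sup>2))) (at (x i))" for x
  proof -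
    define q where "q = (\<Sum>j\<in>{..<n} - {i}. (x j)\<^sup>2)"
    have eq: "(\<Sum>j<n. ((x(i := t)) j)\<^sup>2) = t\<^sup>2 + q" for t
      unfolding q_def by (rule sum_sq_fun_upd[OF \<open>i < n\<close>])
    have eq': "(\<Sum>j<n. (x j)\<^sup>2) = (x i)\<^sup>2 + q"
      using eq[of "x i"] by simp
    have "((\<lambda>t. t\<^sup>2 + q) has_real_derivative 2 * x i) (at (x i))"
      by (auto intro!: derivative_eq_intros)
    from DERIV_chain2[OF smooth_on_has_deriv[OF radial.hyps UNIV_I] this]
    show ?thesis unfolding eq eq' by (simp add: mult_ac)
  qed
  then show ?case using radial_poly.coord[OF \<open>i < n\<close> radial_poly.radial[OF s]] by blast
next
  case (coord j u)
  then obtain u' where u': "radial_poly n u'" "\<And>x. ((\<lambda>t. u (x(i := t))) has_real_derivative u' x) (at (x i))"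
    by blast
  show ?case
  proof (cases "i = j")
    case True
    have "((\<lambda>t. (x(i := t)) j * u (x(i := t))) has_real_derivative u x + x j * u' x) (at (x i))" for x
      using DERIV_mult[OF DERIV_ident u'(2)[of x]] True by (simp add: add.commute mult.commute)
    then show ?thesis using radial_poly.add[OF coord(2) radial_poly.coord[OF coord(1) u'(1)]] by blast
  next
    case False
    have "((\<lambda>t. (x(i := t)) j * u (x(i := t))) has_real_derivative x j * u' x) (at (x i))" for x
      using DERIV_cmult[OF u'(2)[of x]] False by simp
    then show ?thesis using radial_poly.coord[OF coord(1) u'(1)] by blast
  qed
next
  case (add u v)
  then obtain u' v' where u': "radial_poly n u'" "\<And>x. ((\<lambda>t. u (x(i := t))) has_real_derivative u' x) (at (x i))"
    and v': "radial_poly n v'" "\<And>x. ((\<lambda>t. v (x(i := t))) has_real_derivative v' x) (at (x i))"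
    by blast
  have "((\<lambda>t. u (x(i := t)) + v (x(i := t))) has_real_derivative u' x + v' x) (at (x i))" for x
    by (rule DERIV_add[OF u'(2)[of x] v'(2)[of x]])
  then show ?case using radial_poly.add[OF u'(1) v'(1)] by blast
qed

lemma radial_poly_continuous: "radial_poly n u \<Longrightarrow> continuous_on UNIV u"
proof (induction rule: radial_poly.induct)
  case (radial h)
  have "continuous_on UNIV h"
    using smooth_on_has_deriv[OF radial] by (meson DERIV_continuous_on UNIV_I)
  moreover have "continuous_on UNIV (\<lambda>x :: nat \<Rightarrow> real. \<Sum>j<n. (x j)\<^sup>2)"
    by (intro continuous_on_sum continuous_on_power continuous_on_product_coordinates)
  ultimately show ?case
    by (rule continuous_on_compose2) simp
qed (intro continuous_on_add continuous_on_mult continuous_on_product_coordinates; assumption)+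

lemma radial_poly_partial_deriv:
  assumes "radial_poly n u" "i < n"
  shows "radial_poly n (partial_deriv i u)" "(\<lambda>t. u (x(i := t))) differentiable at (x i)"
proof -
  obtain u' where u': "radial_poly n u'" "\<And>x. ((\<lambda>t. u (x(i := t))) has_real_derivative u' x) (at (x i))"
    using radial_poly_deriv[OF assms] by blast
  then have "partial_deriv i u = u'"
    by (auto simp: partial_deriv_def DERIV_imp_deriv)
  with u' show "radial_poly n (partial_deriv i u)" by simp
  show "(\<lambda>t. u (x(i := t))) differentiable at (x i)"
    using u'(2)[of x] by (auto simp: real_differentiable_def)
qed

lemma radial_poly_smooth_Rn:
  assumes "radial_poly n u"
  shows "smooth_Rn n u"
proof -
  have rp: "radial_poly n (foldr partial_deriv js u)" if "set js \<subseteq> {..<n}" for js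
    using that by (induction js) (auto intro: assms radial_poly_partial_deriv)
  show ?thesis
    unfolding smooth_Rn_def
    using radial_poly_partial_deriv(2)[OF rp] continuous_on_subset[OF radial_poly_continuous[OF rp]] by auto
qed

text \<open>The support lies in a product of intervals for the first n coordinates and singletons
  \<open>{undefined}\<close> for all others. This box is compact by Tychonoff's theorem, although
  the ambient function space has infinitely many coordinates.\<close>

lemma compact_support_RnI:
  assumes "\<And>x. x \<in> Rn n \<Longrightarrow> L2_set x {..<n} \<ge> R \<Longrightarrow> u x = 0"
  shows "compact_support_Rn n u"
proof -
  define K where "K = PiE UNIV (\<lambda>i. if i < n then {- R..R} else {undefined :: real})"
  have "compactin (product_topology (\<lambda>_. euclidean) UNIV) K"
    unfolding K_def by (subst compactin_PiE) auto
  then have K: "compact K"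
    by (simp add: euclidean_product_topology)
  have "{x \<in> Rn n. u x \<noteq> 0} \<subseteq> K"
  proof safe
    fix x assume x: "x \<in> Rn n" "u x \<noteq> 0"
    then have "L2_set x {..<n} < R" using assms by force
    moreover have "\<bar>x i\<bar> \<le> L2_set x {..<n}" if "i < n" for i
      using member_le_L2_set[of "{..<n}" i "\<lambda>j. \<bar>x j\<bar>"] that by (simp add: L2_set_def)
    ultimately have "\<bar>x i\<bar> \<le> R" if "i < n" for i using that by force
    then have "x i \<in> (if i < n then {- R..R} else {undefined})" for i
      using x(1) PiE_arb[of x "{..<n}" "\<lambda>_. UNIV" i] by (simp add: Rn_def abs_le_iff minus_le_iff)
    then show "x \<in> K" by (simp add: K_def PiE_def)
  qed
  then have "closure {x \<in> Rn n. u x \<noteq> 0} \<subseteq> K"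
    by (rule closure_minimal) (rule compact_imp_closed[OF K])
  then have "closure {x \<in> Rn n. u x \<noteq> 0} = K \<inter> closure {x \<in> Rn n. u x \<noteq> 0}"
    by blast
  then show ?thesis
    unfolding compact_support_Rn_def
    by (rule ssubst[where P=compact]) (rule compact_Int_closed[OF K closed_closure])
qed

section \<open>Completing the square\<close>

lemma space_lebesgue_Rn: "space (lebesgue_Rn n) = Rn n"
  by (simp add: lebesgue_Rn_def Rn_def space_PiM)

lemma integrable_half_line:
  fixes F :: "real \<Rightarrow> real"
  assumes "continuous_on {0..T} F" "\<And>r. r > T \<Longrightarrow> F r = 0"
  shows "integrable lborel (\<lambda>r. indicator {0<..} r * F r)"
proof -
  have "set_integrable lborel {0<..T} F"
    by (rule set_integrable_subset[OF borel_integrable_atLeastAtMost'[OF assms(1)]]) auto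
  moreover have "(\<lambda>r. indicator {0<..T} r *\<^sub>R F r) = (\<lambda>r. indicator {0<..} r * F r)"
    using assms(2) by (auto simp: fun_eq_iff indicator_def not_le)
  ultimately show ?thesis by (simp add: set_integrable_def)
qed

text \<open>At the end points only continuity is asked for: at 0 the real powers in the boundary
  terms are not differentiated.\<close>

lemma integral_deriv_half_line:
  fixes F F' :: "real \<Rightarrow> real"
  assumes "T \<ge> 0" "continuous_on {0..T} F" "continuous_on {0..T} F'"
    and "\<And>r. 0 < r \<Longrightarrow> r < T \<Longrightarrow> (F has_real_derivative F' r) (at r)"
    and "\<And>r. r > T \<Longrightarrow> F' r = 0"
  shows "(LINT r|lborel. indicator {0<..} r * F' r) = F T - F 0"
proof -
  have int: "set_integrable lborel {0..T} F'"
    by (rule borel_integrable_atLeastAtMost'[OF assms(3)])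
  have "(LINT r|lborel. indicator {0<..} r * F' r) = (LINT r:{0..T}|lborel. F' r)"
    unfolding set_lebesgue_integral_def
  proof (rule integral_cong_AE)
    show "(\<lambda>r. indicator {0<..} r * F' r) \<in> borel_measurable lborel"
      using integrable_half_line[OF assms(3,5)] by (rule borel_measurable_integrable)
    show "(\<lambda>x. indicator {0..T} x *\<^sub>R F' x) \<in> borel_measurable lborel"
      using int unfolding set_integrable_def by (rule borel_measurable_integrable)
    show "AE x in lborel. indicator {0<..} x * F' x = indicator {0..T} x *\<^sub>R F' x"
      using AE_lborel_singleton[of 0] by eventually_elim (use assms(5) in \<open>auto simp: indicator_def not_le\<close>)
  qed
  also have "\<dots> = integral {0..T} F'"
    by (rule set_borel_integral_eq_integral[OF int])
  also have "(F' has_integral (F T - F 0)) {0..T}"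
    by (rule fundamental_theorem_of_calculus_interior[OF assms(1,2)])
       (use assms(4) in \<open>auto simp: has_real_derivative_iff_has_vector_derivative\<close>)
  then have "integral {0..T} F' = F T - F 0"
    by (rule integral_unique)
  finally show ?thesis .
qed

text \<open>Bounds a Dirichlet integral away from 0, both for a single function and uniformly along
  the trial sequence.\<close>

lemma integral_ge_on_interval:
  fixes F :: "real \<Rightarrow> real"
  assumes "integrable lborel F" "\<And>r. F r \<ge> 0" "\<And>r. p \<le> r \<Longrightarrow> r \<le> q \<Longrightarrow> F r \<ge> c" "p \<le> q"
  shows "(LINT r|lborel. F r) \<ge> c * (q - p)"
proof -
  have "c * (q - p) = (LINT r|lborel. c * indicator {p..q} r)"
    using assms(4) by simp
  also have "\<dots> \<le> (LINT r|lborel. F r)"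
  proof (rule integral_mono)
    show "integrable lborel (\<lambda>r. c * indicator {p..q} r)"
      by (intro integrable_mult_right integrable_real_indicator) (use assms(4) in auto)
  qed (use assms in \<open>auto simp: indicator_def\<close>)
  finally show ?thesis .
qed

text \<open>The weighted square of the overview for a function with profile f, including the
  Jacobian r^(n - 1) but not the surface constant, which cancels in the quotient.\<close>

definition defect :: "nat \<Rightarrow> real \<Rightarrow> real \<Rightarrow> (real \<Rightarrow> real) \<Rightarrow> (real \<Rightarrow> real) \<Rightarrow> (real \<Rightarrow> real) \<Rightarrow> real \<Rightarrow> real" where
  "defect n \<alpha> b f f' f'' r = r ^ (n - 1) *
     ((f'' r + (real n - 1) * f' r / r + r powr (2 * \<alpha>) * (r * f' r + b * f r))\<^sup>2 / r powr (2 * \<alpha>))"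

text \<open>The last group on the left is the derivative of r^n f'^2 + 2b r^(n - 1) f f' + b r^(n +
  2\<alpha>) f^2. All integrations by parts are thereby condensed into one pointwise identity and
  one exact derivative.\<close>

lemma completed_square:
  fixes f f' f'' :: "real \<Rightarrow> real"
  assumes n: "n \<ge> 2" and r: "r > 0"
    and b: "b\<^sup>2 = b * (real n + 2 * \<alpha>) - 2 * (\<alpha> + 1) * k"
  shows "r ^ (n - 1) * ((f'' r + (real n - 1) * f' r / r)\<^sup>2 / r powr (2 * \<alpha>))
     + r ^ (n - 1) * (r powr (2 * \<alpha> + 2) * (f' r)\<^sup>2 - 2 * (\<alpha> + 1) * k * r powr (2 * \<alpha>) * (f r)\<^sup>2)
     - (2 * b - real n + 2) * (r ^ (n - 1) * (f' r)\<^sup>2)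
     + (real n * r ^ (n - 1) * (f' r)\<^sup>2 + 2 * r ^ n * f' r * f'' r
        + 2 * b * ((real n - 1) * r ^ (n - 2) * f r * f' r + r ^ (n - 1) * ((f' r)\<^sup>2 + f r * f'' r))
        + b * ((real n + 2 * \<alpha>) * r powr (real n + 2 * \<alpha> - 1) * (f r)\<^sup>2
               + 2 * r powr (real n + 2 * \<alpha>) * f r * f' r))
   = defect n \<alpha> b f f' f'' r"
proof -
  define E where "E = r ^ (n - 2)"
  define Q where "Q = r powr (2 * \<alpha>)"
  define m where "m = real n"
  obtain j where j: "n = j + 2" using n by (metis add.commute le_Suc_ex)
  have e1: "r ^ (n - 1) = r * E" "r ^ n = r * r * E" "r ^ (n - 2) = E"
    by (auto simp: E_def j)
  have "r powr real n = r * r * E" using r e1 by (simp add: powr_realpow)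
  then have e2: "r powr (2 * \<alpha> + 2) = r * r * Q" "r powr (m + 2 * \<alpha>) = r * r * E * Q"
    "r powr (m + 2 * \<alpha> - 1) = r * E * Q"
    using r by (simp_all add: Q_def m_def powr_add powr_diff power2_eq_square)
  have Q: "Q > 0" using r by (simp add: Q_def)
  show ?thesis
    unfolding defect_def m_def[symmetric] e1 e2 Q_def[symmetric]
  proof (rule eq_iff_diff_eq_0[THEN iffD2], goal_cases)
    case 1
    \<comment> \<open>The terms containing f' or f'' cancel identically; what is left is f^2 times
      the quadratic polynomial of which b is a root.\<close>
    have "?case \<longleftrightarrow> r * E * Q * (f r)\<^sup>2 * (b * (m + 2 * \<alpha>) - 2 * (\<alpha> + 1) * k - b\<^sup>2) = 0"
      by (rule arg_cong[where f="\<lambda>x. x = 0"])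
         (use r Q in \<open>simp add: field_simps power2_eq_square\<close>)
    then show ?case using b by (simp add: m_def)
  qed
qed

text \<open>
  At the origin \<open>laplacian n u\<close> need not agree with the radial formula, where \<open>f' r / r\<close> is junk; the functions
  \<open>G\<close> below record the actual value there, so that no almost-everywhere argument is needed on the space.
\<close>

lemma integrable_laplacian_iff:
  assumes n: "n \<ge> 1"
    and u: "\<And>x. x \<in> Rn n \<Longrightarrow> u x = f (L2_set x {..<n})"
    and f: "\<And>t. (f has_real_derivative f' t) (at t)" "\<And>t. (f' has_real_derivative f'' t) (at t)"
    and [measurable]: "f'' \<in> borel_measurable borel"
  shows "integrable (lebesgue_Rn n) (\<lambda>x. (laplacian n u x)\<^sup>2 / L2_set x {..<n} powr (2 * \<alpha>)) \<longleftrightarrow>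
     integrable lborel (\<lambda>r. indicator {0<..} r * (r ^ (n - 1) * ((f'' r + (real n - 1) * f' r / r)\<^sup>2 / r powr (2 * \<alpha>))))"
proof -
  define G where "G r = (if r = 0 then laplacian n u (axis_pt n 0) else f'' r + (real n - 1) * f' r / r)\<^sup>2
    / r powr (2 * \<alpha>)" for r
  have [measurable]: "f' \<in> borel_measurable borel"
    by (intro borel_measurable_continuous_onI DERIV_continuous_on[OF f(2)])
  have [measurable]: "G \<in> borel_measurable borel"
    unfolding G_def[abs_def] by measurable
  have lap: "(laplacian n u x)\<^sup>2 / L2_set x {..<n} powr (2 * \<alpha>) = G (L2_set x {..<n})" if "x \<in> Rn n" for x
    using radial_laplacian[OF that _ u f(1) f(2)] Rn_L2_set_zero[OF that]
    by (cases "L2_set x {..<n} = 0") (simp_all add: G_def)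
  have "integrable (lebesgue_Rn n) (\<lambda>x. (laplacian n u x)\<^sup>2 / L2_set x {..<n} powr (2 * \<alpha>)) \<longleftrightarrow>
      integrable (lebesgue_Rn n) (\<lambda>x. G (L2_set x {..<n}))"
    by (rule Bochner_Integration.integrable_cong) (auto simp: space_lebesgue_Rn lap)
  also have "\<dots> \<longleftrightarrow> integrable lborel (\<lambda>r. indicator {0<..} r * (r ^ (n - 1) * G r))"
    unfolding lebesgue_Rn_def by (rule polar_integrable[OF n]) simp
  also have "(\<lambda>r. indicator {0<..} r * (r ^ (n - 1) * G r)) =
      (\<lambda>r. indicator {0<..} r * (r ^ (n - 1) * ((f'' r + (real n - 1) * f' r / r)\<^sup>2 / r powr (2 * \<alpha>))))"
    by (auto simp: fun_eq_iff indicator_def G_def)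
  finally show ?thesis .
qed

text \<open>Both bounds for the infimum rest on this identity. Admissibility makes the weighted
  Laplacian term integrable; the other terms are continuous up to 0, because n + 2\<alpha> > 1, and
  vanish for large r, so the defect is integrable too.\<close>

lemma quotient_eq_defect:
  assumes n: "n \<ge> 2" "real n + 2 * \<alpha> > 1"
    and b: "b\<^sup>2 = b * (real n + 2 * \<alpha>) - 2 * (\<alpha> + 1) * real k"
    and u: "u \<in> admissible n \<alpha>" "\<And>x. x \<in> Rn n \<Longrightarrow> u x = f (L2_set x {..<n})"
    and f: "\<And>t. (f has_real_derivative f' t) (at t)" "\<And>t. (f' has_real_derivative f'' t) (at t)"
      "continuous_on UNIV f''" "\<And>t. \<bar>t\<bar> \<ge> R \<Longrightarrow> f t = 0"
  shows "integrable lborel (\<lambda>r. indicator {0<..} r * defect n \<alpha> b f f' f'' r)" (is "integrable _ ?S")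
    and "integrable lborel (\<lambda>r. indicator {0<..} r * (r ^ (n - 1) * (f' r)\<^sup>2))" (is "integrable _ ?B")
    and "(LINT r|lborel. indicator {0<..} r * (r ^ (n - 1) * (f' r)\<^sup>2)) > 0"
    and "quotient n \<alpha> k u = 2 * b - real n + 2
      + (LINT r|lborel. indicator {0<..} r * defect n \<alpha> b f f' f'' r)
        / (LINT r|lborel. indicator {0<..} r * (r ^ (n - 1) * (f' r)\<^sup>2))"
proof -
  \<comment> \<open>Strictly beyond R, so that f and both derivatives vanish at T itself.\<close>
  define T where "T = \<bar>R\<bar> + 1"
  have T: "T > 0" "T > R" by (auto simp: T_def)
  have cf: "continuous_on A f" and cf': "continuous_on A f'" and cf'': "continuous_on A f''" for A
    using f(3) by (auto intro: DERIV_continuous_on[OF has_field_derivative_at_within[OF f(1)]]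
       DERIV_continuous_on[OF has_field_derivative_at_within[OF f(2)]] continuous_on_subset)
  have [measurable]: "f \<in> borel_measurable borel" "f' \<in> borel_measurable borel" "f'' \<in> borel_measurable borel"
    by (auto intro: borel_measurable_continuous_onI cf cf' cf'')
  have z: "f r = 0" "f' r = 0" "f'' r = 0" if r: "r > R" "r > 0" for r
  proof -
    have ev: "\<forall>\<^sub>F t in nhds r. t \<in> {max R 0<..}"
      by (rule eventually_nhds_in_open) (use r in auto)
    show "f r = 0" using f(4)[of r] r by simp
    have z': "f' r = 0" if r: "r > R" "r > 0" for r
    proof -
      have "\<forall>\<^sub>F t in nhds r. t \<in> {max R 0<..}"
        by (rule eventually_nhds_in_open) (use r in auto)
      then have "\<forall>\<^sub>F t in nhds r. f t = 0"
        by (rule eventually_mono) (use f(4) in auto)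
      from DERIV_cong_ev[OF refl this refl] have "((\<lambda>_. 0) has_real_derivative f' r) (at r)"
        using f(1) by blast
      then show ?thesis using DERIV_unique DERIV_const by blast
    qed
    show "f' r = 0" by (rule z'[OF r])
    have "\<forall>\<^sub>F t in nhds r. f' t = 0"
      using ev by (rule eventually_mono) (use z' in auto)
    from DERIV_cong_ev[OF refl this refl] have "((\<lambda>_. 0) has_real_derivative f'' r) (at r)"
      using f(2) by blast
    then show "f'' r = 0" using DERIV_unique DERIV_const by blast
  qed
  define \<sigma> where "\<sigma> = real n * unit_ball_vol (real n)"
  have \<sigma>: "\<sigma> > 0" using n by (simp add: \<sigma>_def)
  define G1 where "G1 r = (if r = 0 then laplacian n u (axis_pt n 0) else f'' r + (real n - 1) * f' r / r)\<^sup>2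
    / r powr (2 * \<alpha>)" for r
  define G3 where "G3 r = (if r = 0 then grad_norm_sq n u (axis_pt n 0) else (f' r)\<^sup>2)" for r
  define G2 where "G2 r = r powr (2 * \<alpha> + 2) * G3 r - 2 * (\<alpha> + 1) * real k * r powr (2 * \<alpha>) * (f r)\<^sup>2" for r
  have [measurable]: "G1 \<in> borel_measurable borel" "G2 \<in> borel_measurable borel" "G3 \<in> borel_measurable borel"
    unfolding G1_def[abs_def] G2_def[abs_def] G3_def[abs_def] by measurable
  have lap: "(laplacian n u x)\<^sup>2 / L2_set x {..<n} powr (2 * \<alpha>) = G1 (L2_set x {..<n})" if "x \<in> Rn n" for x
    using radial_laplacian[OF that _ u(2) f(1) f(2)] Rn_L2_set_zero[OF that]
    by (cases "L2_set x {..<n} = 0") (simp_all add: G1_def)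
  have grad: "grad_norm_sq n u x = G3 (L2_set x {..<n})" if "x \<in> Rn n" for x
    using radial_grad_norm_sq[OF that _ u(2) f(1)] Rn_L2_set_zero[OF that]
    by (cases "L2_set x {..<n} = 0") (simp_all add: G3_def)
  have n1: "n \<ge> 1" using n by simp
  let ?J = "\<lambda>G. LINT r|lborel. indicator {0<..} r * (r ^ (n - 1) * G r :: real)"
  have int1: "integrable lborel (\<lambda>r. indicator {0<..} r * (r ^ (n - 1) * G1 r))"
  proof -
    have "(\<lambda>r. indicator {0<..} r * (r ^ (n - 1) * G1 r)) =
      (\<lambda>r. indicator {0<..} r * (r ^ (n - 1) * ((f'' r + (real n - 1) * f' r / r)\<^sup>2 / r powr (2 * \<alpha>))))"
      by (auto simp: fun_eq_iff indicator_def G1_def)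
    moreover have "integrable (lebesgue_Rn n) (\<lambda>x. (laplacian n u x)\<^sup>2 / L2_set x {..<n} powr (2 * \<alpha>))"
      using u(1) by (simp add: admissible_def)
    ultimately show ?thesis
      using integrable_laplacian_iff[OF n1 u(2) f(1,2), of \<alpha>] by simp
  qed
  have v1: "(LINT x|lebesgue_Rn n. (laplacian n u x)\<^sup>2 / L2_set x {..<n} powr (2 * \<alpha>)) = \<sigma> * ?J G1"
  proof -
    have "(LINT x|lebesgue_Rn n. (laplacian n u x)\<^sup>2 / L2_set x {..<n} powr (2 * \<alpha>))
      = (LINT x|lebesgue_Rn n. G1 (L2_set x {..<n}))"
      by (rule Bochner_Integration.integral_cong) (auto simp: space_lebesgue_Rn lap)
    then show ?thesis
      unfolding lebesgue_Rn_def \<sigma>_def by (subst (asm) polar_integral[OF n1]) simp_all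
  qed
  have v3: "(LINT x|lebesgue_Rn n. grad_norm_sq n u x) = \<sigma> * ?J G3"
  proof -
    have "(LINT x|lebesgue_Rn n. grad_norm_sq n u x) = (LINT x|lebesgue_Rn n. G3 (L2_set x {..<n}))"
      by (rule Bochner_Integration.integral_cong) (auto simp: space_lebesgue_Rn grad)
    then show ?thesis
      unfolding lebesgue_Rn_def \<sigma>_def by (subst (asm) polar_integral[OF n1]) simp_all
  qed
  have v2: "(LINT x|lebesgue_Rn n. L2_set x {..<n} powr (2 * \<alpha> + 2) * grad_norm_sq n u x
         - 2 * (\<alpha> + 1) * real k * L2_set x {..<n} powr (2 * \<alpha>) * (u x)\<^sup>2) = \<sigma> * ?J G2"
  proof -
    have "(LINT x|lebesgue_Rn n. L2_set x {..<n} powr (2 * \<alpha> + 2) * grad_norm_sq n u x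
         - 2 * (\<alpha> + 1) * real k * L2_set x {..<n} powr (2 * \<alpha>) * (u x)\<^sup>2)
       = (LINT x|lebesgue_Rn n. G2 (L2_set x {..<n}))"
      by (rule Bochner_Integration.integral_cong) (auto simp: space_lebesgue_Rn grad G2_def u(2))
    then show ?thesis
      unfolding lebesgue_Rn_def \<sigma>_def by (subst (asm) polar_integral[OF n1]) simp_all
  qed
  define H where "H r = r ^ n * (f' r)\<^sup>2 + 2 * b * (r ^ (n - 1) * f r * f' r)
    + b * (r powr (real n + 2 * \<alpha>) * (f r)\<^sup>2)" for r
  define H' where "H' r = real n * r ^ (n - 1) * (f' r)\<^sup>2 + 2 * r ^ n * f' r * f'' r
        + 2 * b * ((real n - 1) * r ^ (n - 2) * f r * f' r + r ^ (n - 1) * ((f' r)\<^sup>2 + f r * f'' r))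
        + b * ((real n + 2 * \<alpha>) * r powr (real n + 2 * \<alpha> - 1) * (f r)\<^sup>2
               + 2 * r powr (real n + 2 * \<alpha>) * f r * f' r)" for r
  have dH: "(H has_real_derivative H' r) (at r)" if "r > 0" for r
  proof -
    have e: "real (n - Suc 0) = real n - 1" "n - Suc (Suc 0) = n - 2" using n by auto
    show ?thesis unfolding H_def H'_def
      by (rule derivative_eq_intros f refl that | simp)+
         (use that in \<open>simp add: e power2_eq_square powr_diff algebra_simps\<close>)
  qed
  have cpowr: "continuous_on {0..T} (\<lambda>r. r powr e)" if "e > 0" for e :: real
    by (rule continuous_on_powr') (use that in auto)
  note cont = continuous_on_add continuous_on_diff continuous_on_mult continuous_on_power
    continuous_on_const continuous_on_id cf cf' cf'' cpowr
  have cH: "continuous_on {0..T} H"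
    unfolding H_def by (intro cont) (use n in simp)
  have cH': "continuous_on {0..T} H'"
    unfolding H'_def by (intro cont) (use n in simp_all)
  have zH': "H' r = 0" if "r > T" for r
    using z[of r] that T by (simp add: H'_def)
  have intH': "integrable lborel (\<lambda>r. indicator {0<..} r * H' r)"
    by (rule integrable_half_line[OF cH' zH'])
  have "(LINT r|lborel. indicator {0<..} r * H' r) = H T - H 0"
    by (rule integral_deriv_half_line[OF less_imp_le[OF T(1)] cH cH' dH zH'])
  \<comment> \<open>At 0 each summand of H carries a positive power of r, and at T the profile is
    zero.\<close>
  also have "\<dots> = 0"
    using z[of T] T n by (simp add: H_def zero_power)
  finally have JH': "(LINT r|lborel. indicator {0<..} r * H' r) = 0" .
  have intB: "integrable lborel ?B"
    by (rule integrable_half_line[of T], intro cont) (use z T in simp)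
  have B_eq: "(\<lambda>r. indicator {0<..} r * (r ^ (n - 1) * G3 r)) = ?B"
    by (auto simp: fun_eq_iff indicator_def G3_def)
  have int2: "integrable lborel (\<lambda>r. indicator {0<..} r * (r ^ (n - 1) * G2 r))"
  proof -
    have "integrable lborel (\<lambda>r. indicator {0<..} r * (r powr (real n + 2 * \<alpha> + 1) * (f' r)\<^sup>2
      - 2 * (\<alpha> + 1) * real k * r powr (real n + 2 * \<alpha> - 1) * (f r)\<^sup>2))"
      by (rule integrable_half_line[of T], intro cont) (use z T n in simp_all)
    also have "(\<lambda>r. indicator {0<..} r * (r powr (real n + 2 * \<alpha> + 1) * (f' r)\<^sup>2
      - 2 * (\<alpha> + 1) * real k * r powr (real n + 2 * \<alpha> - 1) * (f r)\<^sup>2))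
      = (\<lambda>r. indicator {0<..} r * (r ^ (n - 1) * G2 r))"
    proof (rule ext)
      fix r :: real
      have "r powr (real n + 2 * \<alpha> + 1) = r ^ (n - 1) * r powr (2 * \<alpha> + 2)"
        "r powr (real n + 2 * \<alpha> - 1) = r ^ (n - 1) * r powr (2 * \<alpha>)" if "r > 0"
        using that n by (simp_all add: powr_realpow[symmetric] powr_add[symmetric] of_nat_diff algebra_simps)
      then show "indicator {0<..} r * (r powr (real n + 2 * \<alpha> + 1) * (f' r)\<^sup>2
      - 2 * (\<alpha> + 1) * real k * r powr (real n + 2 * \<alpha> - 1) * (f r)\<^sup>2)
      = indicator {0<..} r * (r ^ (n - 1) * G2 r)"
        by (cases "r > 0") (simp_all add: G2_def G3_def algebra_simps)
    qed
    finally show ?thesis .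
  qed
  let ?I1 = "\<lambda>r. indicator {0<..} r * (r ^ (n - 1) * G1 r)"
  let ?I2 = "\<lambda>r. indicator {0<..} r * (r ^ (n - 1) * G2 r)"
  let ?I4 = "\<lambda>r. indicator {0<..} r * H' r"
  have S_eq: "?S = (\<lambda>r. ?I1 r + ?I2 r - (2 * b - real n + 2) * ?B r + ?I4 r)"
  proof (rule ext)
    fix r :: real
    show "?S r = ?I1 r + ?I2 r - (2 * b - real n + 2) * ?B r + ?I4 r"
    proof (cases "r > 0")
      case True
      then show ?thesis
        using completed_square[OF n(1) True b, of f'' f' f]
        by (simp add: G1_def G2_def G3_def H'_def)
    qed simp
  qed
  show intS: "integrable lborel ?S"
    unfolding S_eq
    by (intro Bochner_Integration.integrable_add Bochner_Integration.integrable_diff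
        integrable_mult_right int1 int2 intB intH')
  show "integrable lborel ?B" by (rule intB)
  have JS: "integral\<^sup>L lborel ?S = ?J G1 + ?J G2 - (2 * b - real n + 2) * integral\<^sup>L lborel ?B"
    unfolding S_eq using int1 int2 intB intH' JH' by simp
  \<comment> \<open>Otherwise f would be constant on the positive axis, equal to its value 0 at
    large radius, and u would vanish everywhere.\<close>
  have "\<exists>t>0. f' t \<noteq> 0"
  proof (rule ccontr)
    assume "\<not> (\<exists>t>0. f' t \<noteq> 0)"
    then have f'0: "f' t = 0" if "t > 0" for t using that by blast
    have "f r = 0" if "r \<ge> 0" for r
    proof (cases "r \<ge> R")
      case True
      then show ?thesis using f(4) that by simp
    next
      case False
      then obtain z where "r < z" "f R - f r = (R - r) * f' z"
        using MVT2[of r R f f'] f(1) by auto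
      then show ?thesis using f'0[of z] that False f(4)[of R] by simp
    qed
    then have "u x = 0" if "x \<in> Rn n" for x
      using u(2)[OF that] L2_set_nonneg by simp
    then show False using u(1) by (auto simp: admissible_def)
  qed
  then obtain t where t: "t > 0" "f' t \<noteq> 0" by blast
  define c where "c = t ^ (n - 1) * (\<bar>f' t\<bar> / 2)\<^sup>2"
  have "c > 0" using t by (simp add: c_def)
  have "isCont f' t" using f(2) DERIV_isCont by blast
  then have "((\<lambda>x. \<bar>f' x\<bar>) \<longlongrightarrow> \<bar>f' t\<bar>) (at t)"
    unfolding isCont_def by (intro tendsto_intros)
  then have "\<forall>\<^sub>F x in at t. \<bar>f' x\<bar> > \<bar>f' t\<bar> / 2"
    by (rule order_tendstoD) (use t in simp)
  then obtain d where d: "d > 0" "\<And>x. x \<noteq> t \<Longrightarrow> dist x t < d \<Longrightarrow> \<bar>f' x\<bar> > \<bar>f' t\<bar> / 2"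
    unfolding eventually_at by blast
  have "c * (t + d / 2 - t) \<le> integral\<^sup>L lborel ?B"
  proof (rule integral_ge_on_interval[OF intB])
    fix r assume r: "t \<le> r" "r \<le> t + d / 2"
    then have "\<bar>f' r\<bar> \<ge> \<bar>f' t\<bar> / 2"
      using d(1) d(2)[of r] by (cases "r = t") (auto simp: dist_real_def)
    then have "(\<bar>f' t\<bar> / 2)\<^sup>2 \<le> (f' r)\<^sup>2"
      using power_mono[of "\<bar>f' t\<bar> / 2" "\<bar>f' r\<bar>" 2] by simp
    moreover have "t ^ (n - 1) \<le> r ^ (n - 1)" using r t by (intro power_mono) auto
    ultimately have "c \<le> r ^ (n - 1) * (f' r)\<^sup>2"
      unfolding c_def using t r by (intro mult_mono) auto
    then show "c \<le> ?B r" using r t by simp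
  qed (use d in \<open>auto simp: indicator_def\<close>)
  then show B0: "integral\<^sup>L lborel ?B > 0"
    using \<open>c > 0\<close> d(1) by (smt (verit) mult_pos_pos half_gt_zero)
  have "quotient n \<alpha> k u = (\<sigma> * ?J G1 + \<sigma> * ?J G2) / (\<sigma> * integral\<^sup>L lborel ?B)"
    unfolding quotient_def v1 v2 v3 B_eq ..
  also have "\<dots> = (?J G1 + ?J G2) / integral\<^sup>L lborel ?B"
    using \<sigma> by (simp add: distrib_left[symmetric])
  also have "\<dots> = 2 * b - real n + 2 + integral\<^sup>L lborel ?S / integral\<^sup>L lborel ?B"
    using B0 unfolding JS by (simp add: field_simps)
  finally show "quotient n \<alpha> k u = 2 * b - real n + 2 + integral\<^sup>L lborel ?S / integral\<^sup>L lborel ?B" .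
qed

section \<open>Truncated Kummer profiles\<close>

lemma smooth_step_derivs_0:
  assumes "x < 1 \<or> x > 2"
  shows "deriv smooth_step x = 0" "deriv (deriv smooth_step) x = 0"
proof -
  have 1: "deriv smooth_step x = 0" if "x < 1 \<or> x > 2" for x
  proof (cases "x < 1")
    case True
    then have "deriv smooth_step x = deriv (\<lambda>_. 0) x"
      by (intro deriv_cong_open[of "{..<1}"]) (auto intro: smooth_step_0)
    then show ?thesis by simp
  next
    case False
    with that have "deriv smooth_step x = deriv (\<lambda>_. 1) x"
      by (intro deriv_cong_open[of "{2<..}"]) (auto intro: smooth_step_1)
    then show ?thesis by simp
  qed
  show "deriv smooth_step x = 0" by (rule 1[OF assms])
  show "deriv (deriv smooth_step) x = 0"
  proof (cases "x < 1")
    case True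
    then have "deriv (deriv smooth_step) x = deriv (\<lambda>_. 0) x"
      by (intro deriv_cong_open[of "{..<1}"]) (auto intro: 1)
    then show ?thesis by simp
  next
    case False
    with assms have "deriv (deriv smooth_step) x = deriv (\<lambda>_. 0) x"
      by (intro deriv_cong_open[of "{2<..}"]) (auto intro: 1)
    then show ?thesis by simp
  qed
qed

lemma smooth_step_has_deriv:
  "(smooth_step has_real_derivative deriv smooth_step x) (at x)"
  "(deriv smooth_step has_real_derivative deriv (deriv smooth_step) x) (at x)"
  by (rule smooth_on_has_deriv[OF smooth_on_smooth_step UNIV_I]
      smooth_on_has_deriv[OF smooth_on_deriv[OF smooth_on_smooth_step] UNIV_I])+

lemma smooth_on_continuous: "smooth_on UNIV f \<Longrightarrow> continuous_on A f"
  by (rule DERIV_continuous_on[OF has_field_derivative_at_within[OF smooth_on_has_deriv[of UNIV]]]) auto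

lemma continuous_bounded_Icc:
  fixes f :: "real \<Rightarrow> real"
  assumes "continuous_on {p..q} f"
  shows "\<exists>M. \<forall>x\<in>{p..q}. \<bar>f x\<bar> \<le> M"
  using compact_imp_bounded[OF compact_continuous_image[OF assms compact_Icc]]
  unfolding bounded_iff by auto

text \<open>The weights x and x^2 make the bounds invariant under dilation, so a single M serves the
  truncations at every scale. The derivatives vanish outside [1, 2], where compactness supplies the
  bound.\<close>

lemma smooth_step_bounds:
  obtains M where "M \<ge> 0" "\<And>x. \<bar>smooth_step x\<bar> \<le> M" "\<And>x. \<bar>x * deriv smooth_step x\<bar> \<le> M"
    "\<And>x. \<bar>x\<^sup>2 * deriv (deriv smooth_step) x\<bar> \<le> M"
proof -
  note s = smooth_on_smooth_step
  have "continuous_on {1..2} (\<lambda>x. smooth_step x)" "continuous_on {1..2} (\<lambda>x. x * deriv smooth_step x)"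
    "continuous_on {1..2} (\<lambda>x. x\<^sup>2 * deriv (deriv smooth_step) x)"
    by (intro continuous_on_mult continuous_on_power continuous_on_id smooth_on_continuous[OF s]
        smooth_on_continuous[OF smooth_on_deriv[OF s]]
        smooth_on_continuous[OF smooth_on_deriv[OF smooth_on_deriv[OF s]]])+
  then obtain M0 M1 M2 where M: "\<forall>x\<in>{1..2}. \<bar>smooth_step x\<bar> \<le> M0" "\<forall>x\<in>{1..2}. \<bar>x * deriv smooth_step x\<bar> \<le> M1"
     "\<forall>x\<in>{1..2}. \<bar>x\<^sup>2 * deriv (deriv smooth_step) x\<bar> \<le> M2"
    using continuous_bounded_Icc[of 1 2 smooth_step] continuous_bounded_Icc[of 1 2 "\<lambda>x. x * deriv smooth_step x"]
      continuous_bounded_Icc[of 1 2 "\<lambda>x. x\<^sup>2 * deriv (deriv smooth_step) x"] by blast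
  define K where "K = 1 + \<bar>M0\<bar> + \<bar>M1\<bar> + \<bar>M2\<bar>"
  have K: "K \<ge> 0" "1 \<le> K" "M0 \<le> K" "M1 \<le> K" "M2 \<le> K" by (auto simp: K_def)
  show ?thesis
  proof (rule that[OF K(1)])
    fix x :: real
    consider "x < 1" | "x > 2" | "x \<in> {1..2}" by force
    then have "\<bar>smooth_step x\<bar> \<le> K \<and> \<bar>x * deriv smooth_step x\<bar> \<le> K \<and> \<bar>x\<^sup>2 * deriv (deriv smooth_step) x\<bar> \<le> K"
    proof cases
      case 1
      then show ?thesis using K by (simp add: smooth_step_derivs_0 smooth_step_0)
    next
      case 2
      then show ?thesis using K by (simp add: smooth_step_derivs_0 smooth_step_1)
    next
      case 3
      show ?thesis using bspec[OF M(1) 3] bspec[OF M(2) 3] bspec[OF M(3) 3] K by linarith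
    qed
    then show "\<bar>smooth_step x\<bar> \<le> K" "\<bar>x * deriv smooth_step x\<bar> \<le> K" "\<bar>x\<^sup>2 * deriv (deriv smooth_step) x\<bar> \<le> K"
      by auto
  qed
qed

lemma integrable_powr_tail:
  fixes e \<rho> :: real
  assumes "e < -1" "\<rho> > 0"
  shows "integrable lborel (\<lambda>r. indicator {\<rho>..} r * r powr e)"
proof (rule integrableI_nonneg)
  have "(\<integral>\<^sup>+ r. ennreal (r powr e) * indicator {\<rho>..} r \<partial>lborel) = ennreal (0 - \<rho> powr (e + 1) / (e + 1))"
  proof (rule nn_integral_FTC_atLeast)
    show "((\<lambda>r. r powr (e + 1) / (e + 1)) \<longlongrightarrow> 0) at_top"
      using tendsto_divide[OF tendsto_neg_powr[OF _ filterlim_ident, of "e + 1"] tendsto_const[of "e + 1"]] assms by simp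
    show "DERIV (\<lambda>r. r powr (e + 1) / (e + 1)) x :> x powr e" if "\<rho> \<le> x" for x
      using that assms by (auto intro!: derivative_eq_intros)
  qed auto
  also have "(\<lambda>r. ennreal (r powr e) * indicator {\<rho>..} r) = (\<lambda>r. ennreal (indicator {\<rho>..} r * r powr e))"
    by (auto simp: fun_eq_iff indicator_def)
  finally show "(\<integral>\<^sup>+ r. ennreal (indicator {\<rho>..} r * r powr e) \<partial>lborel) < \<infinity>"
    by simp
qed auto

text \<open>The inequalities for b say A < c and 2A > c: the first is used for the power series, the
  second for the integrability of the truncation error at infinity.\<close>

locale kummer_profile =
  fixes n :: nat and \<alpha> b :: real
  assumes n: "n \<ge> 4" and \<alpha>: "\<alpha> > -1" and b: "b < real n + 2 * \<alpha>" "real n + 2 * \<alpha> < 2 * b"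
begin

definition "m = 2 * \<alpha> + 2"
definition "A = b / m"
definition "c = (real n + 2 * \<alpha>) / m"

lemma m_pos: "m > 0" using \<alpha> by (simp add: m_def)
lemma A_pos: "A > 0" and A_less_c: "A < c" and c_pos: "c > 0"
  using m_pos b n \<alpha> by (auto simp: A_def c_def divide_simps)

definition "g = eval_fps (kummer_fps A c)"
definition "g1 = eval_fps (fps_deriv (kummer_fps A c))"
definition "g2 = eval_fps (fps_deriv (fps_deriv (kummer_fps A c)))"

lemma conv_radius:
  "fps_conv_radius (kummer_fps A c) = \<infinity>"
  "fps_conv_radius (fps_deriv (kummer_fps A c)) = \<infinity>"
  "fps_conv_radius (fps_deriv (fps_deriv (kummer_fps A c))) = \<infinity>"
  using kummer_conv_radius[OF A_pos A_less_c] fps_conv_radius_deriv[of "kummer_fps A c"]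
    fps_conv_radius_deriv[of "fps_deriv (kummer_fps A c)"] by auto

lemma g_deriv: "(g has_real_derivative g1 s) (at s)" "(g1 has_real_derivative g2 s) (at s)"
  unfolding g_def g1_def g2_def by (rule has_field_derivative_eval_fps; simp add: conv_radius)+

lemma smooth_on_g: "smooth_on UNIV g"
  unfolding g_def by (rule smooth_on_eval_fps) (rule conv_radius)

lemma continuous_on_g: "continuous_on S g" "continuous_on S g1" "continuous_on S g2"
  unfolding g_def g1_def g2_def by (rule smooth_on_continuous smooth_on_eval_fps conv_radius)+

lemma g_ode: "s * g2 s + (c + s) * g1 s + A * g s = 0"
  unfolding g_def g1_def g2_def by (rule kummer_ode[OF A_pos A_less_c])

lemma g_0: "g 0 = 1" and g1_0: "g1 0 = - (A / c)"
  using c_pos by (simp_all add: g_def g1_def eval_fps_at_0 kummer_fps_def)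

text \<open>Near 0 the linear bound on g - 1 pays for the one factor 1/s left over when the inner
  step is differentiated. For large s no bound on \<open>g2\<close> is listed, since there the
  second derivative enters only through the equation.\<close>

lemma g_bounds:
  obtains K where "K \<ge> 0" "\<And>s. 0 < s \<Longrightarrow> s \<le> 1 \<Longrightarrow> \<bar>g s - 1\<bar> \<le> K * s \<and> \<bar>g1 s\<bar> \<le> K \<and> \<bar>g2 s\<bar> \<le> K"
    "\<And>s. s \<ge> 1 \<Longrightarrow> \<bar>g s\<bar> \<le> K * s powr (- A) \<and> \<bar>s * g1 s\<bar> \<le> K * s powr (- A)"
proof -
  obtain K0 where K0: "\<forall>s\<ge>1. \<bar>g s\<bar> \<le> K0 * s powr (- A) \<and> \<bar>s * g1 s\<bar> \<le> K0 * s powr (- A)"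
    using kummer_decay[of g g1 g2 c A] g_deriv g_ode by blast
  obtain K1 K2 where K12: "\<forall>x\<in>{0..1}. \<bar>g1 x\<bar> \<le> K1" "\<forall>x\<in>{0..1}. \<bar>g2 x\<bar> \<le> K2"
    using continuous_bounded_Icc[OF continuous_on_g(2)] continuous_bounded_Icc[OF continuous_on_g(3)] by blast
  define K where "K = \<bar>K0\<bar> + \<bar>K1\<bar> + \<bar>K2\<bar>"
  have K: "K \<ge> 0" "K0 \<le> K" "K1 \<le> K" "K2 \<le> K" by (auto simp: K_def)
  show ?thesis
  proof (rule that[OF K(1)])
    fix s :: real assume s: "0 < s" "s \<le> 1"
    obtain z where z: "0 < z" "z < s" "g s - g 0 = (s - 0) * g1 z"
      using MVT2[of 0 s g g1] g_deriv(1) s by blast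
    then have "\<bar>g s - 1\<bar> = \<bar>g1 z\<bar> * s" using s g_0 by (simp add: abs_mult)
    also have "\<bar>g1 z\<bar> \<le> K" using bspec[OF K12(1), of z] z s K by auto
    finally have "\<bar>g s - 1\<bar> \<le> K * s" using s by simp
    moreover have "\<bar>g1 s\<bar> \<le> K" "\<bar>g2 s\<bar> \<le> K"
      using bspec[OF K12(1), of s] bspec[OF K12(2), of s] s K by auto
    ultimately show "\<bar>g s - 1\<bar> \<le> K * s \<and> \<bar>g1 s\<bar> \<le> K \<and> \<bar>g2 s\<bar> \<le> K" by blast
  next
    fix s :: real assume s: "s \<ge> 1"
    have "K0 * s powr (- A) \<le> K * s powr (- A)" using K by (intro mult_right_mono) auto
    then show "\<bar>g s\<bar> \<le> K * s powr (- A) \<and> \<bar>s * g1 s\<bar> \<le> K * s powr (- A)"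
      using K0[rule_format, OF s] by linarith
  qed
qed

text \<open>
  The suffixes 1 and 2 mark first and second derivatives. The factor \<open>P\<close> cuts off where \<open>s\<close> is of order
  \<open>J\<close>, and \<open>X\<close> flattens the Kummer function to the constant 1 where \<open>s\<close> is of order \<open>1/J\<close>.
\<close>

definition "P J s = 1 - smooth_step (s / J)"
definition "P1 J s = - deriv smooth_step (s / J) / J"
definition "P2 J s = - deriv (deriv smooth_step) (s / J) / J\<^sup>2"
definition "X J s = smooth_step (J * s)"
definition "X1 J s = J * deriv smooth_step (J * s)"
definition "X2 J s = J\<^sup>2 * deriv (deriv smooth_step) (J * s)"
definition "Y J s = 1 + X J s * (g s - 1)"
definition "Y1 J s = X1 J s * (g s - 1) + X J s * g1 s"
definition "Y2 J s = X2 J s * (g s - 1) + 2 * X1 J s * g1 s + X J s * g2 s"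
definition "G J s = P J s * Y J s"
definition "G1 J s = P1 J s * Y J s + P J s * Y1 J s"
definition "G2 J s = P2 J s * Y J s + 2 * P1 J s * Y1 J s + P J s * Y2 J s"

lemma G_deriv:
  assumes "J > 0"
  shows "(G J has_real_derivative G1 J s) (at s)" "(G1 J has_real_derivative G2 J s) (at s)"
proof -
  have dsc: "((\<lambda>s. s / J) has_real_derivative 1 / J) (at s)" "((\<lambda>s. J * s) has_real_derivative J) (at s)"
    using assms by (auto intro!: derivative_eq_intros)
  have dP: "(P J has_real_derivative P1 J s) (at s)"
    unfolding P_def[abs_def] P1_def
    by (rule DERIV_cong[OF DERIV_diff[OF DERIV_const DERIV_chain2[OF smooth_step_has_deriv(1) dsc(1)]]]) simp
  have dP1: "(P1 J has_real_derivative P2 J s) (at s)"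
    unfolding P1_def[abs_def] P2_def
    by (rule DERIV_cong[OF DERIV_cdivide[OF DERIV_minus[OF DERIV_chain2[OF smooth_step_has_deriv(2) dsc(1)]]]])
       (use assms in \<open>simp add: power2_eq_square\<close>)
  have dX: "(X J has_real_derivative X1 J s) (at s)"
    unfolding X_def[abs_def] X1_def
    by (rule DERIV_cong[OF DERIV_chain2[OF smooth_step_has_deriv(1) dsc(2)]]) simp
  have dX1: "(X1 J has_real_derivative X2 J s) (at s)"
    unfolding X1_def[abs_def] X2_def
    by (rule DERIV_cong[OF DERIV_cmult[OF DERIV_chain2[OF smooth_step_has_deriv(2) dsc(2)]]])
       (simp add: power2_eq_square)
  have dg: "((\<lambda>s. g s - 1) has_real_derivative g1 s) (at s)"
    using DERIV_diff[OF g_deriv(1)[of s] DERIV_const[of 1]] by simp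
  have dY: "(Y J has_real_derivative Y1 J s) (at s)"
    unfolding Y_def[abs_def] Y1_def
    by (rule DERIV_cong[OF DERIV_add[OF DERIV_const DERIV_mult[OF dX dg]]]) (simp add: algebra_simps)
  have dY1: "(Y1 J has_real_derivative Y2 J s) (at s)"
    unfolding Y1_def[abs_def] Y2_def
    by (rule DERIV_cong[OF DERIV_add[OF DERIV_mult[OF dX1 dg] DERIV_mult[OF dX g_deriv(2)]]])
       (simp add: algebra_simps)
  show "(G J has_real_derivative G1 J s) (at s)"
    unfolding G_def[abs_def] G1_def
    by (rule DERIV_cong[OF DERIV_mult[OF dP dY]]) (simp add: algebra_simps)
  show "(G1 J has_real_derivative G2 J s) (at s)"
    unfolding G1_def[abs_def] G2_def
    by (rule DERIV_cong[OF DERIV_add[OF DERIV_mult[OF dP1 dY] DERIV_mult[OF dP dY1]]])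
       (simp add: algebra_simps)
qed

lemma smooth_on_G:
  assumes "J > 0"
  shows "smooth_on UNIV (G J)"
proof -
  have lin: "smooth_on UNIV (\<lambda>s. s * d)" for d :: real
    by (intro smooth_on_mult smooth_on_ident smooth_on_const) auto
  have "smooth_on UNIV (\<lambda>s. (1 - smooth_step (s * (1 / J))) * (1 + smooth_step (s * J) * (g s - 1)))"
    by (intro smooth_on_mult smooth_on_add smooth_on_diff smooth_on_const smooth_on_g open_UNIV
        smooth_on_compose[OF open_UNIV open_UNIV smooth_on_smooth_step lin UNIV_I])
  then show ?thesis
    by (simp add: G_def[abs_def] P_def Y_def X_def mult.commute)
qed

lemma cut_inner:
  assumes "J > 0" "s < J"
  shows "P J s = 1" "P1 J s = 0" "P2 J s = 0"
  using assms by (simp_all add: P_def P1_def P2_def smooth_step_0 smooth_step_derivs_0)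

lemma cut_outer:
  assumes "J * s > 2"
  shows "Y J s = g s" "Y1 J s = g1 s" "Y2 J s = g2 s"
  using assms by (simp_all add: Y_def Y1_def Y2_def X_def X1_def X2_def smooth_step_1 smooth_step_derivs_0)

text \<open>
  The residual of \<open>G J\<close> in Kummer's equation. The commutator terms involve only \<open>s P1\<close>, \<open>s\<^sup>2 P2\<close>,
  \<open>s X1\<close> and \<open>s\<^sup>2 X2\<close>, which are scale invariant and hence bounded uniformly in \<open>J\<close>.
\<close>

definition "Kd J s = s * G2 J s + (c + s) * G1 J s + A * G J s"

text \<open>For 2/J < s < J both steps are constant and \<open>G J\<close> is the Kummer function
  itself. These windows exhaust the half-line as J grows.\<close>

lemma Kd_eq_0:
  assumes "J > 0" "s < J" "J * s > 2"
  shows "Kd J s = 0" "G1 J s = g1 s"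
  using g_ode[of s] by (simp_all add: Kd_def G_def G1_def G2_def cut_inner[OF assms(1,2)] cut_outer[OF assms(3)])

text \<open>For J \<ge> 3 the inner step varies only where s \<le> 2/J < 1 and the outer one only
  where s \<ge> J > 1. The two truncations never interact, and s = 1 separates them.\<close>

lemma Kd_bounded:
  obtains C where "C \<ge> 0" "\<And>J s. J \<ge> 3 \<Longrightarrow> 0 < s \<Longrightarrow> s \<le> 1 \<Longrightarrow> \<bar>Kd J s\<bar> \<le> C"
    "\<And>J s. J \<ge> 3 \<Longrightarrow> s > 1 \<Longrightarrow> \<bar>Kd J s\<bar> \<le> C * s powr (- A)"
proof -
  obtain M where M: "M \<ge> 0" "\<And>x. \<bar>smooth_step x\<bar> \<le> M" "\<And>x. \<bar>x * deriv smooth_step x\<bar> \<le> M"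
    "\<And>x. \<bar>x\<^sup>2 * deriv (deriv smooth_step) x\<bar> \<le> M"
    using smooth_step_bounds by blast
  obtain K where K: "K \<ge> 0" "\<And>s. 0 < s \<Longrightarrow> s \<le> 1 \<Longrightarrow> \<bar>g s - 1\<bar> \<le> K * s \<and> \<bar>g1 s\<bar> \<le> K \<and> \<bar>g2 s\<bar> \<le> K"
    "\<And>s. s \<ge> 1 \<Longrightarrow> \<bar>g s\<bar> \<le> K * s powr (- A) \<and> \<bar>s * g1 s\<bar> \<le> K * s powr (- A)"
    using g_bounds by blast
  define C1 where "C1 = 4 * (M * K) + (c + 1) * (2 * (M * K)) + A * (1 + M * K)"
  define C2 where "C2 = (c + 4) * (M * K)"
  have MK: "M * K \<ge> 0" using M K by simp
  have C12: "C1 \<ge> 0" "C2 \<ge> 0" using MK A_pos c_pos by (auto simp: C1_def C2_def)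
  have abs_mult_le: "\<bar>x * y\<bar> \<le> p * q" if "\<bar>x\<bar> \<le> p" "\<bar>y\<bar> \<le> q" for x y p q :: real
    using that by (simp add: abs_mult mult_mono')
  have le1: "\<bar>Kd J s\<bar> \<le> C1" if J: "J \<ge> 3" and s: "0 < s" "s \<le> 1" for J s
  proof -
    have cut: "P J s = 1" "P1 J s = 0" "P2 J s = 0" using cut_inner[of J s] J s by auto
    have X: "\<bar>X J s\<bar> \<le> M" "\<bar>s * X1 J s\<bar> \<le> M" "\<bar>s\<^sup>2 * X2 J s\<bar> \<le> M"
      using M(2)[of "J * s"] M(3)[of "J * s"] M(4)[of "J * s"]
      by (simp_all add: X_def X1_def X2_def power_mult_distrib mult_ac)
    have gs: "\<bar>(g s - 1) / s\<bar> \<le> K" "\<bar>g1 s\<bar> \<le> K" "\<bar>g2 s\<bar> \<le> K" "\<bar>g s - 1\<bar> \<le> K"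
    proof -
      have "K * s \<le> K * 1" using K(1) s by (intro mult_left_mono) auto
      then show "\<bar>(g s - 1) / s\<bar> \<le> K" "\<bar>g1 s\<bar> \<le> K" "\<bar>g2 s\<bar> \<le> K" "\<bar>g s - 1\<bar> \<le> K"
        using K(2)[OF s] s by (auto simp: abs_divide divide_le_eq)
    qed
    have e: "X2 J s * (g s - 1) * s = (s\<^sup>2 * X2 J s) * ((g s - 1) / s)"
      "X1 J s * (g s - 1) = (s * X1 J s) * ((g s - 1) / s)"
      using s by (simp_all add: power2_eq_square)
    define t1 t2 t3 t4 t5 t6 where "t1 = (s\<^sup>2 * X2 J s) * ((g s - 1) / s)"
      and "t2 = (s * X1 J s) * g1 s" and "t3 = X J s * g2 s"
      and "t4 = (s * X1 J s) * ((g s - 1) / s)" and "t5 = X J s * g1 s" and "t6 = X J s * (g s - 1)"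
    have t: "\<bar>t1\<bar> \<le> M * K" "\<bar>t2\<bar> \<le> M * K" "\<bar>t3\<bar> \<le> M * K" "\<bar>t4\<bar> \<le> M * K" "\<bar>t5\<bar> \<le> M * K" "\<bar>t6\<bar> \<le> M * K"
      unfolding t1_def t2_def t3_def t4_def t5_def t6_def by (intro abs_mult_le X gs)+
    have "Kd J s = s * Y2 J s + (c + s) * Y1 J s + A * Y J s"
      by (simp add: Kd_def G_def G1_def G2_def cut)
    also have "\<dots> = t1 + 2 * t2 + s * t3 + (c + s) * (t4 + t5) + A * (1 + t6)"
      using e unfolding Y_def Y1_def Y2_def t1_def[symmetric] t4_def[symmetric]
      by (simp add: t2_def t3_def t5_def t6_def algebra_simps)
    finally have "\<bar>Kd J s\<bar> \<le> \<bar>t1\<bar> + 2 * \<bar>t2\<bar> + \<bar>s * t3\<bar> + \<bar>(c + s) * (t4 + t5)\<bar> + \<bar>A * (1 + t6)\<bar>"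
      by linarith
    moreover have "\<bar>s * t3\<bar> \<le> 1 * (M * K)" "\<bar>(c + s) * (t4 + t5)\<bar> \<le> (c + 1) * (2 * (M * K))"
      "\<bar>A * (1 + t6)\<bar> \<le> A * (1 + M * K)"
      by (rule abs_mult_le; use t s c_pos A_pos in linarith)+
    ultimately show ?thesis using t unfolding C1_def by linarith
  qed
  have le2: "\<bar>Kd J s\<bar> \<le> C2 * s powr (- A)" if J: "J \<ge> 3" and s: "s > 1" for J s
  proof -
    define w where "w = K * s powr (- A)"
    have "J * 1 < J * s" using J s by (intro mult_strict_left_mono) auto
    then have Js: "J * s > 2" using J by linarith
    note cut = cut_outer[OF Js]
    have P: "\<bar>s * P1 J s\<bar> \<le> M" "\<bar>s\<^sup>2 * P2 J s\<bar> \<le> M"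
      using M(3)[of "s / J"] M(4)[of "s / J"]
      by (simp_all add: P1_def P2_def power_divide)
    have gs: "\<bar>g s\<bar> \<le> w" "\<bar>s * g1 s\<bar> \<le> w" using K(3)[of s] s by (auto simp: w_def)
    define t1 t2 t3 where "t1 = (s\<^sup>2 * P2 J s) * g s" and "t2 = (s * P1 J s) * (s * g1 s)"
      and "t3 = (s * P1 J s) * g s"
    have t: "\<bar>t1\<bar> \<le> M * w" "\<bar>t2\<bar> \<le> M * w" "\<bar>t3\<bar> \<le> M * w"
      unfolding t1_def t2_def t3_def by (intro abs_mult_le P gs)+
    \<comment> \<open>The last bracket is Kummer's equation for g, so only the commutator with the
      cut-off remains. Its terms gain a factor 1/s except for s P1 g from the first-order part,
      which is as large as g; hence the residual decays no better than s^(-A).\<close>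
    have "Kd J s = s * (P2 J s * g s) + 2 * (s * (P1 J s * g1 s)) + (c + s) * (P1 J s * g s)
        + P J s * (s * g2 s + (c + s) * g1 s + A * g s)"
      by (simp add: Kd_def G_def G1_def G2_def cut algebra_simps)
    also have "\<dots> = 1 / s * t1 + 2 * (1 / s * t2) + (c / s + 1) * t3"
      using s unfolding g_ode by (simp add: t1_def t2_def t3_def power2_eq_square field_simps)
    finally have "\<bar>Kd J s\<bar> \<le> \<bar>1 / s * t1\<bar> + 2 * \<bar>1 / s * t2\<bar> + \<bar>(c / s + 1) * t3\<bar>"
      by linarith
    moreover have "\<bar>1 / s * t1\<bar> \<le> 1 * (M * w)" "\<bar>1 / s * t2\<bar> \<le> 1 * (M * w)"
      using t s by (intro abs_mult_le; simp)+
    moreover have "\<bar>(c / s + 1) * t3\<bar> \<le> (c + 1) * (M * w)"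
    proof (rule abs_mult_le)
      have "c / s \<le> c" "c / s \<ge> 0" using s c_pos by (auto simp: field_simps)
      then show "\<bar>c / s + 1\<bar> \<le> c + 1" by linarith
    qed (rule t)
    moreover have "(c + 4) * (M * w) = M * w + 2 * (M * w) + (c + 1) * (M * w)"
      by (simp add: algebra_simps)
    ultimately have "\<bar>Kd J s\<bar> \<le> (c + 4) * (M * w)" by linarith
    then show ?thesis by (simp add: C2_def w_def mult_ac)
  qed
  show ?thesis
  proof (rule that[of "C1 + C2"])
    fix J s :: real assume *: "J \<ge> 3" "s > 1"
    have "C2 * s powr (- A) \<le> (C1 + C2) * s powr (- A)" using C12 by (intro mult_right_mono) auto
    then show "\<bar>Kd J s\<bar> \<le> (C1 + C2) * s powr (- A)" using le2[OF *] by linarith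
  qed (use le1 C12 in force)+
qed

section \<open>Trial functions on the space and their defect\<close>

definition sg :: "real \<Rightarrow> real" where "sg r = r powr m / m"

lemma sg_pos: "r > 0 \<Longrightarrow> sg r > 0"
  using m_pos by (simp add: sg_def)

lemma sg_mono: "0 \<le> r \<Longrightarrow> r \<le> r' \<Longrightarrow> sg r \<le> sg r'"
  using m_pos by (simp add: sg_def divide_right_mono powr_mono2)

lemma sg_root: "s > 0 \<Longrightarrow> sg ((m * s) powr (1 / m)) = s"
  using m_pos by (simp add: sg_def powr_powr)

lemma sg_deriv: "r > 0 \<Longrightarrow> (sg has_real_derivative r powr (m - 1)) (at r)"
  unfolding sg_def[abs_def] using m_pos by (auto intro!: derivative_eq_intros)

lemma G_inner: "J \<ge> 1 \<Longrightarrow> s \<le> 1 / J \<Longrightarrow> G J s = 1"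
proof -
  assume J: "J \<ge> 1" and s: "s \<le> 1 / J"
  then have "J * s \<le> 1" by (simp add: field_simps)
  moreover have "1 / J \<le> 1" using J by simp
  then have "s \<le> J" using s J by linarith
  then have "s / J \<le> 1" using J by simp
  ultimately show ?thesis by (simp add: G_def P_def Y_def X_def smooth_step_0)
qed

lemma G_deriv_inner: "J \<ge> 1 \<Longrightarrow> s < 1 / J \<Longrightarrow> G1 J s = 0 \<and> G2 J s = 0"
proof -
  assume J: "J \<ge> 1" and s: "s < 1 / J"
  then have *: "J * s < 1" by (simp add: field_simps)
  have "1 / J \<le> 1" using J by simp
  then have "s < J" using s J by linarith
  then show ?thesis using J *
    by (simp add: G1_def G2_def cut_inner Y_def Y1_def Y2_def X_def X1_def X2_def
        smooth_step_0 smooth_step_derivs_0)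
qed

lemma G_outer: "J > 0 \<Longrightarrow> s > 2 * J \<Longrightarrow> G J s = 0 \<and> G1 J s = 0 \<and> G2 J s = 0"
  by (simp add: G_def G1_def G2_def P_def P1_def P2_def smooth_step_1 smooth_step_derivs_0 field_simps)

text \<open>The trial profile in terms of q = |x|^2, the variable in which smoothness on the line
  yields smoothness on the space; here s = q^(m/2) / m. The value 1 for q \<le> 0 continues the
  constant core.\<close>

definition "hq J q = (if q \<le> 0 then 1 else G J (q powr (m / 2) / m))"
definition trial :: "real \<Rightarrow> (nat \<Rightarrow> real) \<Rightarrow> real" where
  "trial J x = hq J (\<Sum>j<n. (x j)\<^sup>2)"

lemma smooth_on_hq:
  assumes "J \<ge> 1"
  shows "smooth_on UNIV (hq J)"
proof -
  \<comment> \<open>The value of q for which s = 1/J, up to which \<open>G J\<close> equals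
    1.\<close>
  define \<epsilon> where "\<epsilon> = (m / J) powr (2 / m)"
  have \<epsilon>: "\<epsilon> > 0" using m_pos assms by (simp add: \<epsilon>_def)
  have "smooth_on {0<..} (\<lambda>q. G J (q powr (m / 2) * (1 / m)))"
    by (intro smooth_on_compose[OF open_greaterThan open_UNIV smooth_on_G] smooth_on_mult
        smooth_on_powr smooth_on_const open_greaterThan UNIV_I) (use assms in simp)
  then have 1: "smooth_on {0<..} (hq J)"
    by (subst smooth_on_cong[where g="\<lambda>q. G J (q powr (m / 2) * (1 / m))"]) (auto simp: hq_def)
  have "hq J q = 1" if "q < \<epsilon>" for q
  proof (cases "q \<le> 0")
    case False
    have "q powr (m / 2) \<le> \<epsilon> powr (m / 2)" using False that m_pos by (intro powr_mono2) auto
    also have "\<dots> = m / J" using m_pos assms by (simp add: \<epsilon>_def powr_powr)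
    finally have "q powr (m / 2) / m \<le> 1 / J" using m_pos by (simp add: field_simps)
    then show ?thesis using G_inner[OF assms] False by (simp add: hq_def)
  qed (simp add: hq_def)
  then have 2: "smooth_on {..<\<epsilon>} (hq J)"
    by (subst smooth_on_cong[where g="\<lambda>_. 1"]) (auto intro: smooth_on_const)
  have "{0<..} \<union> {..<\<epsilon>} = UNIV" using \<epsilon> by auto
  then show ?thesis using smooth_on_Un[OF 1 2] by simp
qed

lemma trial_eq: "L2_set x {..<n} > 0 \<Longrightarrow> trial J x = G J (sg (L2_set x {..<n}))"
proof -
  assume r: "L2_set x {..<n} > 0"
  then have "((L2_set x {..<n})\<^sup>2) powr (m / 2) = L2_set x {..<n} powr m"
    by (simp add: powr_powr flip: powr_numeral)
  then show ?thesis using r by (simp add: trial_def sum_sq_L2_set hq_def sg_def)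
qed

lemma trial_regular:
  assumes "J \<ge> 1"
  shows "smooth_Rn n (trial J)" "compact_support_Rn n (trial J)" "radial_Rn n (trial J)"
proof -
  have "radial_poly n (\<lambda>x. hq J (\<Sum>j<n. (x j)\<^sup>2))"
    by (rule radial_poly.radial[OF smooth_on_hq[OF assms]])
  then have "radial_poly n (trial J)" by (simp add: trial_def[abs_def])
  then show "smooth_Rn n (trial J)" by (rule radial_poly_smooth_Rn)
  show "radial_Rn n (trial J)"
    unfolding radial_Rn_def trial_def sum_sq_L2_set by simp
  \<comment> \<open>The radius at which s = 3J; the cut-off has reached 0 already at s = 2J.\<close>
  define T where "T = (m * (3 * J)) powr (1 / m)"
  have T: "T > 0" using m_pos assms by (simp add: T_def)
  show "compact_support_Rn n (trial J)"
  proof (rule compact_support_RnI[of _ T])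
    fix x :: "nat \<Rightarrow> real" assume x: "L2_set x {..<n} \<ge> T"
    have "3 * J = sg T" unfolding T_def using sg_root[of "3 * J"] assms by simp
    also have "\<dots> \<le> sg (L2_set x {..<n})" using sg_mono[of T "L2_set x {..<n}"] x T by simp
    finally show "trial J x = 0"
      using trial_eq[of x J] x T G_outer[of J "sg (L2_set x {..<n})"] assms by simp
  qed
qed

text \<open>The explicit formula through \<open>sg\<close> serves for positive radius only, whereas
  f has to be differentiable on the whole line. The profile therefore comes from the general
  statement about radial functions, and uniqueness of derivatives identifies f' and f'' for r >
  0.\<close>

lemma trial_profile:
  assumes "J \<ge> 1"
  obtains f f' f'' R where
    "\<And>x. x \<in> Rn n \<Longrightarrow> trial J x = f (L2_set x {..<n})"
    "\<And>t. (f has_real_derivative f' t) (at t)"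
    "\<And>t. (f' has_real_derivative f'' t) (at t)"
    "continuous_on UNIV f''" "\<And>t. \<bar>t\<bar> \<ge> R \<Longrightarrow> f t = 0"
    "\<And>r. r > 0 \<Longrightarrow> f r = G J (sg r)"
    "\<And>r. r > 0 \<Longrightarrow> f' r = G1 J (sg r) * r powr (m - 1)"
    "\<And>r. r > 0 \<Longrightarrow> f'' r = G2 J (sg r) * (r powr (m - 1))\<^sup>2 + G1 J (sg r) * ((m - 1) * r powr (m - 2))"
proof -
  have n1: "n \<ge> 1" using n by simp
  obtain f f' f'' R where f: "\<And>x. x \<in> Rn n \<Longrightarrow> trial J x = f (L2_set x {..<n})"
    "\<And>t. (f has_real_derivative f' t) (at t)"
    "\<And>t. (f' has_real_derivative f'' t) (at t)"
    "continuous_on UNIV f''" "\<And>t. \<bar>t\<bar> \<ge> R \<Longrightarrow> f t = 0"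
    by (rule radial_profile[OF n1 trial_regular[OF assms]]) blast
  have J: "J > 0" using assms by simp
  have e0: "f r = G J (sg r)" if "r > 0" for r
    using f(1)[OF axis_pt_Rn, of r] trial_eq[of "axis_pt n r" J] that
    by (simp add: L2_set_axis_pt[OF n1])
  have e1: "f' r = G1 J (sg r) * r powr (m - 1)" if r: "r > 0" for r
  proof -
    have "(f has_real_derivative G1 J (sg r) * r powr (m - 1)) (at r)"
      by (rule has_field_derivative_transform_within_open[OF DERIV_chain2[OF G_deriv(1)[OF J] sg_deriv[OF r]]
            open_greaterThan]) (use r e0 in auto)
    then show ?thesis using f(2) DERIV_unique by blast
  qed
  have e2: "f'' r = G2 J (sg r) * (r powr (m - 1))\<^sup>2 + G1 J (sg r) * ((m - 1) * r powr (m - 2))"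
    if r: "r > 0" for r
  proof -
    have "((\<lambda>r. r powr (m - 1)) has_real_derivative (m - 1) * r powr (m - 2)) (at r)"
      using r by (auto intro!: derivative_eq_intros)
    note d = DERIV_mult[OF DERIV_chain2[OF G_deriv(2)[OF J] sg_deriv[OF r]] this]
    have "(f' has_real_derivative G2 J (sg r) * (r powr (m - 1))\<^sup>2 + G1 J (sg r) * ((m - 1) * r powr (m - 2))) (at r)"
      by (rule has_field_derivative_transform_within_open[OF DERIV_cong[OF d]
            open_greaterThan]) (use r e1 in \<open>auto simp: power2_eq_square algebra_simps\<close>)
    then show ?thesis using f(3) DERIV_unique by blast
  qed
  show ?thesis by (rule that[OF f e0 e1 e2])
qed

text \<open>The possibly singular weight does no harm: the trial function is constant near the
  origin and zero far out, so the integrand is continuous on a compact interval away from 0 and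
  vanishes elsewhere on the half-line.\<close>

lemma trial_admissible:
  assumes "J \<ge> 1"
  shows "trial J \<in> admissible n \<alpha>"
proof -
  have n1: "n \<ge> 1" using n by simp
  obtain f f' f'' R where f: "\<And>x. x \<in> Rn n \<Longrightarrow> trial J x = f (L2_set x {..<n})"
    "\<And>t. (f has_real_derivative f' t) (at t)"
    "\<And>t. (f' has_real_derivative f'' t) (at t)"
    "continuous_on UNIV f''" "\<And>t. \<bar>t\<bar> \<ge> R \<Longrightarrow> f t = 0"
    and e: "\<And>r. r > 0 \<Longrightarrow> f r = G J (sg r)"
    "\<And>r. r > 0 \<Longrightarrow> f' r = G1 J (sg r) * r powr (m - 1)"
    "\<And>r. r > 0 \<Longrightarrow> f'' r = G2 J (sg r) * (r powr (m - 1))\<^sup>2 + G1 J (sg r) * ((m - 1) * r powr (m - 2))"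
    by (rule trial_profile[OF assms]) (rule that)
  define \<Phi> where "\<Phi> r = r ^ (n - 1) * ((f'' r + (real n - 1) * f' r / r)\<^sup>2 / r powr (2 * \<alpha>))" for r
  define \<delta> where "\<delta> = (m * (1 / (2 * J))) powr (1 / m)"
  define T where "T = (m * (3 * J)) powr (1 / m)"
  have \<delta>: "\<delta> > 0" "sg \<delta> = 1 / (2 * J)" and T: "T > 0" "sg T = 3 * J"
    unfolding \<delta>_def T_def using sg_root[of "1 / (2 * J)"] sg_root[of "3 * J"] assms m_pos by auto
  have cf': "continuous_on S f'" and cf'': "continuous_on S f''" for S
    using f(4) by (auto intro: DERIV_continuous_on[OF has_field_derivative_at_within[OF f(3)]] continuous_on_subset)
  have in0: "\<Phi> r = 0" if "0 < r" "r \<le> \<delta>" for r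
  proof -
    have "sg r \<le> 1 / (2 * J)" using sg_mono[of r \<delta>] that \<delta> by simp
    also have "\<dots> < 1 / J" using assms by (simp add: field_simps)
    finally show ?thesis using e that G_deriv_inner[OF assms] by (simp add: \<Phi>_def)
  qed
  have out0: "\<Phi> r = 0" if "r \<ge> T" for r
  proof -
    have "sg r \<ge> 3 * J" using sg_mono[of T r] that T by simp
    then show ?thesis using e that T G_outer[of J "sg r"] assms by (simp add: \<Phi>_def)
  qed
  have "continuous_on {\<delta>..T} \<Phi>"
    unfolding \<Phi>_def
    by (intro continuous_on_mult continuous_on_power continuous_on_divide continuous_on_add
        continuous_on_const continuous_on_id cf' cf'' continuous_on_powr) (use \<delta> in auto)
  from borel_integrable_atLeastAtMost'[OF this]
  have "integrable lborel (\<lambda>r. indicator {\<delta>..T} r *\<^sub>R \<Phi> r)"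
    by (simp add: set_integrable_def)
  also have "(\<lambda>r. indicator {\<delta>..T} r *\<^sub>R \<Phi> r) = (\<lambda>r. indicator {0<..} r * \<Phi> r)"
  proof (rule ext)
    fix r
    show "indicator {\<delta>..T} r *\<^sub>R \<Phi> r = indicator {0<..} r * \<Phi> r"
      using in0[of r] out0[of r] \<delta>(1)
      by (cases "0 < r"; cases "r \<le> \<delta>"; cases "T \<le> r") (simp_all add: indicator_def)
  qed
  finally have "integrable (lebesgue_Rn n) (\<lambda>x. (laplacian n (trial J) x)\<^sup>2 / L2_set x {..<n} powr (2 * \<alpha>))"
    by (subst integrable_laplacian_iff[OF n1 f(1,2,3)])
       (simp_all add: \<Phi>_def borel_measurable_continuous_onI cf'')
  moreover have "trial J (axis_pt n 0) \<noteq> 0"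
    by (simp add: trial_def sum_sq_L2_set L2_set_axis_pt[OF n1] hq_def)
  then have "\<exists>x\<in>Rn n. trial J x \<noteq> 0" using axis_pt_Rn by blast
  ultimately show ?thesis
    using trial_regular[OF assms] by (simp add: admissible_def)
qed

text \<open>The exponent m = 2\<alpha> + 2 is chosen so that r^(m - 2) = r^(2\<alpha>). Then every
  term of the bracket in the defect has this common factor, and the rest is m times Kummer's
  operator, with m c = n + m - 2 and m A = b.\<close>

lemma defect_trial:
  assumes r: "r > 0"
    and e: "f r = G J (sg r)" "f' r = G1 J (sg r) * r powr (m - 1)"
      "f'' r = G2 J (sg r) * (r powr (m - 1))\<^sup>2 + G1 J (sg r) * ((m - 1) * r powr (m - 2))"
  shows "defect n \<alpha> b f f' f'' r = m\<^sup>2 * r powr (real n - 1 + 2 * \<alpha>) * (Kd J (sg r))\<^sup>2"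
proof -
  define Q where "Q = r powr (2 * \<alpha>)"
  have Q: "Q > 0" using r by (simp add: Q_def)
  have p: "r powr (m - 1) = r * Q" "r powr (m - 2) = Q" "r powr m = r * r * Q"
    using r by (simp_all add: Q_def m_def powr_mult_base add.commute power2_eq_square[symmetric])
       (simp_all add: powr_add)
  have s: "m * sg r = r * r * Q" using m_pos by (simp add: sg_def p)
  have d: "(real n - 1) * (G1 J (sg r) * (r * Q)) / r = (real n - 1) * (G1 J (sg r) * Q)"
    using r by simp
  have c: "m * c = real n + m - 2" "m * A = b" using m_pos by (simp_all add: c_def A_def m_def)
  have "f'' r + (real n - 1) * f' r / r + r powr (2 * \<alpha>) * (r * f' r + b * f r)
    = Q * (r * r * Q * G2 J (sg r) + (real n + m - 2 + r * r * Q) * G1 J (sg r) + b * G J (sg r))"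
    unfolding e p Q_def[symmetric] d by (simp add: power2_eq_square algebra_simps)
  also have "\<dots> = Q * ((m * sg r) * G2 J (sg r) + (m * c + m * sg r) * G1 J (sg r) + (m * A) * G J (sg r))"
    unfolding s c by simp
  also have "\<dots> = Q * (m * Kd J (sg r))"
    by (simp add: Kd_def algebra_simps)
  finally have "defect n \<alpha> b f f' f'' r = r ^ (n - 1) * ((Q * (m * Kd J (sg r)))\<^sup>2 / Q)"
    by (simp add: defect_def Q_def)
  also have "\<dots> = m\<^sup>2 * (r ^ (n - 1) * Q) * (Kd J (sg r))\<^sup>2"
    using Q by (simp add: power2_eq_square)
  also have "r ^ (n - 1) * Q = r powr (real n - 1 + 2 * \<alpha>)"
    using r n by (simp add: Q_def powr_add powr_realpow[symmetric] of_nat_diff)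
  finally show ?thesis .
qed

text \<open>Dominated convergence, with a majorant that switches at the radius where s = 1.
  Measurability appears as a premise because it is later inherited from the integrability of the
  defect.\<close>

lemma defect_integral_tendsto:
  assumes meas: "\<And>j. (\<lambda>r. indicator {0<..} r * (m\<^sup>2 * r powr (real n - 1 + 2 * \<alpha>) * (Kd (real j + 3) (sg r))\<^sup>2))
     \<in> borel_measurable lborel" (is "\<And>j. ?S j \<in> _")
  shows "(\<lambda>j. LINT r|lborel. indicator {0<..} r * (m\<^sup>2 * r powr (real n - 1 + 2 * \<alpha>) * (Kd (real j + 3) (sg r))\<^sup>2))
    \<longlonglongrightarrow> 0"
proof -
  obtain C where C: "C \<ge> 0" "\<And>J s. J \<ge> 3 \<Longrightarrow> 0 < s \<Longrightarrow> s \<le> 1 \<Longrightarrow> \<bar>Kd J s\<bar> \<le> C"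
    "\<And>J s. J \<ge> 3 \<Longrightarrow> s > 1 \<Longrightarrow> \<bar>Kd J s\<bar> \<le> C * s powr (- A)"
    by (rule Kd_bounded) blast
  define \<rho> where "\<rho> = (m * 1) powr (1 / m)"
  have \<rho>: "\<rho> > 0" "sg \<rho> = 1" unfolding \<rho>_def using sg_root[of 1] m_pos by auto
  define e1 where "e1 = real n - 1 + 2 * \<alpha>"
  \<comment> \<open>The residual is at most a multiple of s^(-A), and s^(-A) is a constant times
    r^(-b). The squared residual thus adds -2b to the exponent, and \<open>e2 < -1\<close> is the
    condition 2b > n + 2\<alpha>.\<close>
  define e2 where "e2 = real n - 1 + 2 * \<alpha> - 2 * b"
  have e: "e1 > 0" "e2 < -1" using n \<alpha> b by (auto simp: e1_def e2_def)
  define w where "w r = m\<^sup>2 * C\<^sup>2 * (indicator {0..\<rho>} r *\<^sub>R r powr e1)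
     + m\<^sup>2 * (C * m powr A)\<^sup>2 * (indicator {\<rho>..} r * r powr e2)" for r
  have "continuous_on {0..\<rho>} (\<lambda>r. r powr e1)"
    by (rule continuous_on_powr') (use e in auto)
  then have "integrable lborel (\<lambda>r. indicator {0..\<rho>} r *\<^sub>R r powr e1)"
    using borel_integrable_atLeastAtMost' unfolding set_integrable_def by blast
  then have w: "integrable lborel w"
    unfolding w_def
    by (intro Bochner_Integration.integrable_add integrable_mult_right integrable_powr_tail e \<rho>)
  have lim: "(\<lambda>j. ?S j r) \<longlonglongrightarrow> 0" for r
  proof (cases "r > 0")
    case True
    have s: "sg r > 0" using sg_pos[OF True] .
    \<comment> \<open>The threshold secures both s < J and J s > 2 with J = j + 3.\<close>
    have "\<forall>\<^sub>F j in sequentially. real j > sg r + 2 / sg r"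
      using filterlim_real_sequentially filterlim_at_top_dense by blast
    then have "\<forall>\<^sub>F j in sequentially. ?S j r = 0"
    proof (rule eventually_mono)
      fix j assume j: "real j > sg r + 2 / sg r"
      have "2 / sg r > 0" using s by simp
      then have "sg r < real j + 3" "2 / sg r < real j + 3" using j s by linarith+
      then have "Kd (real j + 3) (sg r) = 0"
        using s by (intro Kd_eq_0) (auto simp: field_simps)
      then show "?S j r = 0" by simp
    qed
    then show ?thesis by (rule tendsto_eventually)
  qed simp
  have dom: "norm (?S j r) \<le> w r" for j r
  proof (cases "r > 0")
    case True
    let ?K = "Kd (real j + 3) (sg r)"
    have nn: "0 \<le> m\<^sup>2 * C\<^sup>2 * (indicator {0..\<rho>} r *\<^sub>R r powr e1)"
      "0 \<le> m\<^sup>2 * (C * m powr A)\<^sup>2 * (indicator {\<rho>..} r * r powr e2)" by auto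
    have S: "norm (?S j r) = m\<^sup>2 * r powr e1 * \<bar>?K\<bar>\<^sup>2"
      using True by (simp add: e1_def)
    show ?thesis
    proof (cases "r \<le> \<rho>")
      case le: True
      then have "\<bar>?K\<bar> \<le> C" using sg_mono[of r \<rho>] sg_pos[OF True] True \<rho> by (intro C) auto
      then have "\<bar>?K\<bar>\<^sup>2 \<le> C\<^sup>2" by (intro power_mono) auto
      then have "m\<^sup>2 * r powr e1 * \<bar>?K\<bar>\<^sup>2 \<le> m\<^sup>2 * r powr e1 * C\<^sup>2" by (intro mult_left_mono) auto
      also have "\<dots> = m\<^sup>2 * C\<^sup>2 * (indicator {0..\<rho>} r *\<^sub>R r powr e1)" using le True by simp
      finally show ?thesis unfolding S w_def using nn(2) by linarith
    next
      case gt: False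
      have "sg r > 1"
      proof -
        have "\<rho> powr m < r powr m" using gt \<rho> m_pos by (intro powr_less_mono2) auto
        then have "sg \<rho> < sg r" using m_pos by (simp add: sg_def divide_strict_right_mono)
        then show ?thesis using \<rho> by simp
      qed
      then have "\<bar>?K\<bar> \<le> C * sg r powr (- A)" by (intro C) auto
      also have "sg r powr (- A) = r powr (- b) * m powr A"
        using True m_pos by (simp add: sg_def powr_divide powr_powr A_def powr_minus_divide)
      finally have "\<bar>?K\<bar>\<^sup>2 \<le> (C * (r powr (- b) * m powr A))\<^sup>2" by (intro power_mono) auto
      also have "\<dots> = (C * m powr A)\<^sup>2 * r powr (- 2 * b)"
        by (simp add: power2_eq_square powr_add[symmetric] mult_ac)
      finally have "m\<^sup>2 * r powr e1 * \<bar>?K\<bar>\<^sup>2 \<le> m\<^sup>2 * r powr e1 * ((C * m powr A)\<^sup>2 * r powr (- 2 * b))"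
        by (intro mult_left_mono) auto
      also have "\<dots> = m\<^sup>2 * (C * m powr A)\<^sup>2 * (r powr e1 * r powr (- 2 * b))" by (simp add: mult_ac)
      also have "r powr e1 * r powr (- 2 * b) = indicator {\<rho>..} r * r powr e2"
        using gt by (simp add: e1_def e2_def powr_add[symmetric])
      finally show ?thesis unfolding S w_def using nn(1) by linarith
    qed
  qed (simp add: w_def)
  have "(\<lambda>j. integral\<^sup>L lborel (?S j)) \<longlonglongrightarrow> (LINT r|(lborel :: real measure). 0)"
    by (rule integral_dominated_convergence[where s="?S" and f="\<lambda>_. 0" and w=w]) (use meas w lim dom in auto)
  then show ?thesis by simp
qed

text \<open>The defect integrals tend to 0, so a positive lower bound for the Dirichlet integrals
  that is uniform in j suffices.\<close>

lemma quotient_arbitrarily_close: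
  assumes b2: "b\<^sup>2 = b * (real n + 2 * \<alpha>) - 2 * (\<alpha> + 1) * real k" and "\<epsilon> > 0"
  shows "\<exists>u\<in>admissible n \<alpha>. quotient n \<alpha> k u < 2 * b - real n + 2 + \<epsilon>"
proof -
  let ?S = "\<lambda>j r. indicator {0<..} r * (m\<^sup>2 * r powr (real n - 1 + 2 * \<alpha>) * (Kd (real j + 3) (sg r))\<^sup>2)"
  let ?B = "\<lambda>j r. indicator {0<..} r * (r ^ (n - 1) * (G1 (real j + 3) (sg r) * r powr (m - 1))\<^sup>2)"
  have n2: "n \<ge> 2" "real n + 2 * \<alpha> > 1" using n \<alpha> by auto
  have main: "integrable lborel (?S j)" "integrable lborel (?B j)"
    "quotient n \<alpha> k (trial (real j + 3)) = 2 * b - real n + 2 + integral\<^sup>L lborel (?S j) / integral\<^sup>L lborel (?B j)" for j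
  proof -
    have J: "real j + 3 \<ge> 1" by simp
    obtain f f' f'' R where f: "\<And>x. x \<in> Rn n \<Longrightarrow> trial (real j + 3) x = f (L2_set x {..<n})"
      "\<And>t. (f has_real_derivative f' t) (at t)"
      "\<And>t. (f' has_real_derivative f'' t) (at t)"
      "continuous_on UNIV f''" "\<And>t. \<bar>t\<bar> \<ge> R \<Longrightarrow> f t = 0"
      and e: "\<And>r. r > 0 \<Longrightarrow> f r = G (real j + 3) (sg r)"
      "\<And>r. r > 0 \<Longrightarrow> f' r = G1 (real j + 3) (sg r) * r powr (m - 1)"
      "\<And>r. r > 0 \<Longrightarrow> f'' r = G2 (real j + 3) (sg r) * (r powr (m - 1))\<^sup>2 + G1 (real j + 3) (sg r) * ((m - 1) * r powr (m - 2))"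
      by (rule trial_profile[OF J]) (rule that)
    have S: "?S j = (\<lambda>r. indicator {0<..} r * defect n \<alpha> b f f' f'' r)"
      using defect_trial[of _ f "real j + 3" f' f''] e by (auto simp: fun_eq_iff indicator_def)
    have B: "?B j = (\<lambda>r. indicator {0<..} r * (r ^ (n - 1) * (f' r)\<^sup>2))"
      using e by (auto simp: fun_eq_iff indicator_def)
    show "integrable lborel (?S j)"
      unfolding S by (rule quotient_eq_defect(1)[OF n2 b2 trial_admissible[OF J]]) (fact f)+
    show "integrable lborel (?B j)"
      unfolding B by (rule quotient_eq_defect(2)[OF n2 b2 trial_admissible[OF J]]) (fact f)+
    show "quotient n \<alpha> k (trial (real j + 3)) = 2 * b - real n + 2 + integral\<^sup>L lborel (?S j) / integral\<^sup>L lborel (?B j)"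
      unfolding S B by (rule quotient_eq_defect(4)[OF n2 b2 trial_admissible[OF J]]) (fact f)+
  qed
  have S0: "(\<lambda>j. integral\<^sup>L lborel (?S j)) \<longlonglongrightarrow> 0"
    by (rule defect_integral_tendsto) (rule borel_measurable_integrable[OF main(1)])
  \<comment> \<open>Half of |g'(0)| = A/c, so that g' < -c0 persists near 0.\<close>
  define c0 where "c0 = A / (2 * c)"
  have c0: "c0 > 0" using A_pos c_pos by (simp add: c0_def)
  have "isCont g1 0" using g_deriv(2) DERIV_isCont by blast
  then have "(g1 \<longlongrightarrow> - (A / c)) (at 0)" by (simp add: isCont_def g1_0)
  then have "\<forall>\<^sub>F s in at 0. g1 s < - c0"
    by (rule order_tendstoD) (use A_pos c_pos in \<open>simp add: c0_def field_simps\<close>)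
  then obtain d where d: "d > 0" "\<And>s. s \<noteq> 0 \<Longrightarrow> dist s 0 < d \<Longrightarrow> g1 s < - c0"
    unfolding eventually_at by blast
  \<comment> \<open>The radii p and q at which s = d/4 and s = d/2: on [p, q] the slope bound holds,
    and j > d + 8/d places this interval in the window where \<open>G1\<close> is
    \<open>g1\<close>.\<close>
  define p where "p = (m * (d / 4)) powr (1 / m)"
  define q where "q = (m * (d / 2)) powr (1 / m)"
  have p: "p > 0" "sg p = d / 4" and q: "sg q = d / 2"
    unfolding p_def q_def using sg_root[of "d / 4"] sg_root[of "d / 2"] d m_pos by auto
  have pq: "p < q" unfolding p_def q_def using d m_pos by (intro powr_less_mono2) auto
  \<comment> \<open>The exponent is (n - 1) + 2(m - 1), from the Jacobian and the chain rule; it is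
    positive, so the power is smallest at p.\<close>
  define B0 where "B0 = c0\<^sup>2 * p powr (real n + 4 * \<alpha> + 1) * (q - p)"
  have B0: "B0 > 0" using c0 p pq by (simp add: B0_def)
  have B: "integral\<^sup>L lborel (?B j) \<ge> B0" if j: "real j > d + 8 / d" for j
    unfolding B0_def
  proof (rule integral_ge_on_interval[OF main(2)])
    fix r assume r: "p \<le> r" "r \<le> q"
    then have r0: "r > 0" using p by simp
    have s: "d / 4 \<le> sg r" "sg r \<le> d / 2" using sg_mono[of p r] sg_mono[of r q] r r0 p q by auto
    have s0: "sg r > 0" using sg_pos[OF r0] .
    have "8 / d > 0" using d by simp
    then have j': "real j + 3 > sg r" "real j + 3 > 8 / d" using j s d by linarith+
    have "2 < (real j + 3) * sg r"
    proof -
      have "2 = 8 / d * (d / 4)" using d by simp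
      also have "\<dots> < (real j + 3) * (d / 4)" using j'(2) d by (intro mult_strict_right_mono) auto
      also have "\<dots> \<le> (real j + 3) * sg r" using s by (intro mult_left_mono) auto
      finally show ?thesis .
    qed
    then have G1: "G1 (real j + 3) (sg r) = g1 (sg r)" using j' s0 by (intro Kd_eq_0) auto
    have "g1 (sg r) < - c0" using s s0 d by (intro d) (auto simp: dist_real_def)
    then have "c0\<^sup>2 \<le> (g1 (sg r))\<^sup>2"
      using c0 power_mono[of c0 "- g1 (sg r)" 2] by simp
    moreover have "p powr (real n + 4 * \<alpha> + 1) \<le> r powr (real n + 4 * \<alpha> + 1)"
      using r p n \<alpha> by (intro powr_mono2) auto
    ultimately have "c0\<^sup>2 * p powr (real n + 4 * \<alpha> + 1) \<le> (g1 (sg r))\<^sup>2 * r powr (real n + 4 * \<alpha> + 1)"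
      by (intro mult_mono) auto
    also have "r powr (real n + 4 * \<alpha> + 1) = r ^ (n - 1) * (r powr (m - 1))\<^sup>2"
      using r0 n by (simp add: m_def power2_eq_square powr_realpow[symmetric] of_nat_diff powr_add[symmetric] algebra_simps)
    finally show "c0\<^sup>2 * p powr (real n + 4 * \<alpha> + 1) \<le> ?B j r"
      using r0 by (simp add: G1 power_mult_distrib mult_ac)
  qed (use pq in \<open>auto simp: indicator_def\<close>)
  have "\<forall>\<^sub>F j in sequentially. integral\<^sup>L lborel (?S j) < \<epsilon> * B0"
    by (rule order_tendstoD(2)[OF S0]) (use \<open>\<epsilon> > 0\<close> B0 in simp)
  moreover have "\<forall>\<^sub>F j in sequentially. real j > d + 8 / d"
    using filterlim_real_sequentially filterlim_at_top_dense by blast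
  ultimately have "\<forall>\<^sub>F j in sequentially. quotient n \<alpha> k (trial (real j + 3)) < 2 * b - real n + 2 + \<epsilon>"
  proof eventually_elim
    case (elim j)
    have "\<epsilon> * B0 \<le> \<epsilon> * integral\<^sup>L lborel (?B j)"
      using B[OF elim(2)] \<open>\<epsilon> > 0\<close> by simp
    then have "integral\<^sup>L lborel (?S j) / integral\<^sup>L lborel (?B j) < \<epsilon>"
      using elim(1) B[OF elim(2)] B0 by (simp add: pos_divide_less_eq)
    then show ?case unfolding main(3) by simp
  qed
  then obtain j where "quotient n \<alpha> k (trial (real j + 3)) < 2 * b - real n + 2 + \<epsilon>"
    using eventually_happens' sequentially_bot by blast
  then show ?thesis using trial_admissible[of "real j + 3"] by auto
qed

end

section \<open>The infimum\<close>

lemma INF_quotient: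
  assumes n: "n \<ge> 4" and \<alpha>: "\<alpha> > -1" and b: "b < real n + 2 * \<alpha>" "real n + 2 * \<alpha> < 2 * b"
    and b2: "b\<^sup>2 = b * (real n + 2 * \<alpha>) - 2 * (\<alpha> + 1) * real k"
  shows "(INF u\<in>admissible n \<alpha>. ereal (quotient n \<alpha> k u)) = ereal (2 * b - real n + 2)"
proof (rule INF_eqI)
  fix u assume u: "u \<in> admissible n \<alpha>"
  have n': "n \<ge> 1" "n \<ge> 2" "real n + 2 * \<alpha> > 1" using n \<alpha> by auto
  obtain f f' f'' R where f: "\<And>x. x \<in> Rn n \<Longrightarrow> u x = f (L2_set x {..<n})"
    "\<And>t. (f has_real_derivative f' t) (at t)"
    "\<And>t. (f' has_real_derivative f'' t) (at t)"
    "continuous_on UNIV f''" "\<And>t. \<bar>t\<bar> \<ge> R \<Longrightarrow> f t = 0"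
    by (rule radial_profile[OF n'(1), of u]) (use u in \<open>auto simp: admissible_def\<close>)
  let ?S = "LINT r|lborel. indicator {0<..} r * defect n \<alpha> b f f' f'' r"
  let ?B = "LINT r|lborel. indicator {0<..} r * (r ^ (n - 1) * (f' r)\<^sup>2)"
  have "quotient n \<alpha> k u = 2 * b - real n + 2 + ?S / ?B"
    by (rule quotient_eq_defect(4)[OF n'(2,3) b2 u]) (fact f)+
  moreover have "?S \<ge> 0"
    by (intro Bochner_Integration.integral_nonneg) (auto simp: defect_def indicator_def)
  moreover have "?B \<ge> 0"
    by (intro Bochner_Integration.integral_nonneg) (auto simp: indicator_def)
  ultimately show "ereal (2 * b - real n + 2) \<le> ereal (quotient n \<alpha> k u)" by simp
next
  fix y assume y: "\<And>u. u \<in> admissible n \<alpha> \<Longrightarrow> y \<le> ereal (quotient n \<alpha> k u)"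
  interpret kummer_profile n \<alpha> b by standard (fact n \<alpha> b)+
  show "y \<le> ereal (2 * b - real n + 2)"
  proof (rule ereal_le_epsilon2)
    fix \<epsilon> :: real assume "\<epsilon> > 0"
    then obtain u where "u \<in> admissible n \<alpha>" "quotient n \<alpha> k u < 2 * b - real n + 2 + \<epsilon>"
      using quotient_arbitrarily_close[OF b2] by blast
    then show "y \<le> ereal (2 * b - real n + 2) + ereal \<epsilon>"
      using y[of u] by (auto intro: order_trans)
  qed
qed

text \<open>For n = N + 2k the discriminant (n + 2\<alpha>)^2 - 8(\<alpha> + 1)k equals the radicand
  D of the claim. Its positivity gives 2b > n + 2\<alpha>, and D < (n + 2\<alpha>)^2 gives b < n +
  2\<alpha>.\<close>

lemma C_const_eq:
  assumes "N \<ge> 2" "\<alpha> > -1" "k \<ge> 1"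
  shows "C_const N \<alpha> k = ereal (sqrt ((real N + 2 * \<alpha>)\<^sup>2 + 4 * (real N - 2 + real k) * real k)
                     - (real N + 2 * \<alpha>))"
proof -
  define n where "n = N + 2 * k"
  define p where "p = real n + 2 * \<alpha>"
  define D where "D = (real N + 2 * \<alpha>)\<^sup>2 + 4 * (real N - 2 + real k) * real k"
  define b where "b = (p + sqrt D) / 2"
  have D: "D = p\<^sup>2 - 8 * real k * (\<alpha> + 1)"
    by (simp add: D_def p_def n_def power2_eq_square algebra_simps)
  have "(real N - 2 + real k) * real k > 0" using assms by (intro mult_pos_pos) auto
  then have "4 * (real N - 2 + real k) * real k > 0" by linarith
  then have D0: "D > 0" unfolding D_def by (rule add_nonneg_pos[rotated]) simp
  have p0: "p > 0" using assms by (simp add: p_def n_def)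
  have "D < p\<^sup>2" using assms unfolding D by simp
  then have "sqrt D < p" using p0 real_less_lsqrt[of p D] by simp
  then have b: "b < real n + 2 * \<alpha>" "real n + 2 * \<alpha> < 2 * b"
    using D0 by (auto simp: b_def p_def[symmetric])
  have "(sqrt D)\<^sup>2 = D" using D0 by simp
  then have b2: "b\<^sup>2 = b * (real n + 2 * \<alpha>) - 2 * (\<alpha> + 1) * real k"
    unfolding p_def[symmetric] b_def using D by (simp add: power2_eq_square field_simps)
  have "C_const N \<alpha> k = ereal (2 * b - real n + 2) - ereal (real N + 4 * \<alpha> + 2)"
    unfolding C_const_def n_def[symmetric] using assms
    by (subst INF_quotient[OF _ assms(2) b b2]) (auto simp: n_def)
  also have "2 * b - real n + 2 = sqrt D + 2 * \<alpha> + 2"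
    by (simp add: b_def p_def field_simps)
  finally show ?thesis by (simp add: D_def)
qed

theorem theorem1p1:
  fixes N :: nat and \<alpha> :: real
  assumes "N \<ge> 2" and "\<alpha> > -1"
  shows "(\<forall>k::nat. k \<ge> 1 \<longrightarrow>
            C_const N \<alpha> k =
              ereal (sqrt ((real N + 2 * \<alpha>)\<^sup>2 + 4 * (real N - 2 + real k) * real k)
                     - (real N + 2 * \<alpha>))) \<and>
         (INF k\<in>{1::nat..}. C_const N \<alpha> k) = C_const N \<alpha> 1 \<and>
         C_const N \<alpha> 1 =
           ereal (sqrt ((real N + 2 * \<alpha>)\<^sup>2 + 4 * (real N - 1)) - (real N + 2 * \<alpha>))"
proof (intro conjI allI impI)
  fix k :: nat assume "k \<ge> 1"
  then show "C_const N \<alpha> k = ereal (sqrt ((real N + 2 * \<alpha>)\<^sup>2 + 4 * (real N - 2 + real k) * real k)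
                     - (real N + 2 * \<alpha>))"
    by (rule C_const_eq[OF assms])
next
  show "C_const N \<alpha> 1 = ereal (sqrt ((real N + 2 * \<alpha>)\<^sup>2 + 4 * (real N - 1)) - (real N + 2 * \<alpha>))"
    using C_const_eq[OF assms, of 1] by (simp add: algebra_simps)
  show "(INF k\<in>{1::nat..}. C_const N \<alpha> k) = C_const N \<alpha> 1"
  proof (rule INF_eqI)
    fix k :: nat assume k: "k \<in> {1..}"
    \<comment> \<open>Both factors are nonnegative, since N \<ge> 2, and nondecreasing in k, so the
      radicand is smallest at k = 1.\<close>
    have "(real N - 2 + real 1) * real 1 \<le> (real N - 2 + real k) * real k"
      using k assms by (intro mult_mono) auto
    then have "sqrt ((real N + 2 * \<alpha>)\<^sup>2 + 4 * (real N - 2 + real 1) * real 1)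
      \<le> sqrt ((real N + 2 * \<alpha>)\<^sup>2 + 4 * (real N - 2 + real k) * real k)"
      by (intro real_sqrt_le_mono) linarith
    then show "C_const N \<alpha> 1 \<le> C_const N \<alpha> k"
      using k C_const_eq[OF assms, of 1] C_const_eq[OF assms, of k] by simp
  qed auto
qed

end
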